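(* Let $(X,\mathcal S(X),\mu,T)$ be a nonatomic ergodic finite measure-preserving dynamical system. Suppose further that this dynamical system is not isomorphic mod $0$ to a Kronecker transformation. Then, for any $\mu$-compatible metric $d$ on $X$, $T$ is pairwise sensitive with respect to $d$.
   Context: A finite measure-preserving dynamical system is $(X,\mathcal S(X),\mu,T)$ (also written $(X,\mu,T)$) where $(X,\mathcal S(X))$ is a standard Borel space, $\mu$ is a nonatomic measure on $\mathcal S(X)$ with $0<\mu(X)<\infty$, and $T:X\to X$ is measurable with $\mu(T^{-1}(A))=\mu(A)$ for all $A\in\mathcal S(X)$. All metrics $d:X\times X\to\mathbb R$ are assumed Borel measurable and bounded by $1$. Such a metric $d$ is $\mu$-compatible if every ball $\{y: d(x,y)<\varepsilon\}$ ($x\in X$, $\varepsilon>0$) has positive $\mu$-measure. $T$ is pairwise sensitive with respect to $d$ if there is $\delta>0$ such that for $\mu\otimes\mu$-almost every $(x,y)\in X\times X$ there is $n\ge0$ with $d(T^nx,T^ny)\ge\delta$. Isomorphism mod $0$ of $(X,\mu,T)$ and $(X',\mu',T')$: there are Borel sets $U\subset X$, $U'\subset X'$ with $\mu(X\setminus U)=\mu'(X'\setminus U')=0$, $T(U)\subset U$, $T'(U')\subset U'$, and a measure-preserving (bimeasurable) bijection $\phi:U\to U'$ with $\phi\circ T=T'\circ\phi$ on $U$. A Kronecker transformation is a minimal, uniformly rigid compact group rotation: a map $R:G\to G$, $R(h)=gh$, where $G$ is a compact metrizable topological group and $g\in G$, with $G$ carrying Haar measure (normalized to have total mass $\mu(X)$),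 such that for every $h\in G$ the set of accumulation points of $\{R^nh:n\ge0\}$ is all of $G$, and, for a metric $\rho$ inducing the topology of $G$, there is a sequence $n_i\to\infty$ with $\rho(R^{n_i}h,h)\to0$ uniformly in $h\in G$. *)

theory Defs
  imports "HOL-Analysis.Analysis" "HOL-Algebra.Coset"
begin

section \<open>Measure-preserving systems\<close>

definition standard_Borel :: "'a measure \<Rightarrow> bool" where
  "standard_Borel M \<longleftrightarrow>
     (\<exists>\<tau>. completely_metrizable_space \<tau> \<and> second_countable \<tau> \<and>
          topspace \<tau> = space M \<and> sets M = sigma_sets (space M) {U. openin \<tau> U})"

definition nonatomic :: "'a measure \<Rightarrow> bool" where
  "nonatomic M \<longleftrightarrow>
     (\<forall>A\<in>sets M. 0 < emeasure M A \<longrightarrow>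
        (\<exists>B\<in>sets M. B \<subseteq> A \<and> 0 < emeasure M B \<and> emeasure M B < emeasure M A))"

locale mp_system = finite_measure M for M :: "'a measure" +
  fixes T :: "'a \<Rightarrow> 'a"
  assumes standard_Borel: "standard_Borel M"
    and nonatomic: "nonatomic M"
    and positive_mass: "0 < emeasure M (space M)"
    and measurable_map: "T \<in> M \<rightarrow>\<^sub>M M"
    and preserves_measure: "A \<in> sets M \<Longrightarrow> emeasure M (T -` A \<inter> space M) = emeasure M A"

definition ergodic :: "'a measure \<Rightarrow> ('a \<Rightarrow> 'a) \<Rightarrow> bool" where
  "ergodic M T \<longleftrightarrow>
     (\<forall>A\<in>sets M. T -` A \<inter> space M = A \<longrightarrow>
        emeasure M A = 0 \<or> emeasure M (space M - A) = 0)"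

section \<open>Metrics and pairwise sensitivity\<close>

text \<open>
  \<^term>\<open>Metric_space (space M) d\<close> requires \<open>d\<close> to be symmetric and nonnegative also outside
  \<open>space M\<close>. This excludes no metric on \<open>space M\<close>, since one can put \<open>d = 0\<close> there.
\<close>

definition bounded_Borel_metric :: "'a measure \<Rightarrow> ('a \<Rightarrow> 'a \<Rightarrow> real) \<Rightarrow> bool" where
  "bounded_Borel_metric M d \<longleftrightarrow>
     Metric_space (space M) d \<and>
     (\<lambda>(x, y). d x y) \<in> borel_measurable (M \<Otimes>\<^sub>M M) \<and>
     (\<forall>x\<in>space M. \<forall>y\<in>space M. d x y \<le> 1)"

definition compatible_metric :: "'a measure \<Rightarrow> ('a \<Rightarrow> 'a \<Rightarrow> real) \<Rightarrow> bool" where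
  "compatible_metric M d \<longleftrightarrow>
     bounded_Borel_metric M d \<and>
     (\<forall>x\<in>space M. \<forall>\<epsilon>>0. 0 < emeasure M {y \<in> space M. d x y < \<epsilon>})"

definition pairwise_sensitive ::
    "'a measure \<Rightarrow> ('a \<Rightarrow> 'a) \<Rightarrow> ('a \<Rightarrow> 'a \<Rightarrow> real) \<Rightarrow> bool" where
  "pairwise_sensitive M T d \<longleftrightarrow>
     (\<exists>\<delta>>0. AE (x, y) in M \<Otimes>\<^sub>M M. \<exists>n. \<delta> \<le> d ((T ^^ n) x) ((T ^^ n) y))"

section \<open>Isomorphism modulo null sets\<close>

definition isomorphic_mod_0 ::
    "'a measure \<Rightarrow> ('a \<Rightarrow> 'a) \<Rightarrow> 'b measure \<Rightarrow> ('b \<Rightarrow> 'b) \<Rightarrow> bool" where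
  "isomorphic_mod_0 M T N S \<longleftrightarrow>
     (\<exists>U\<in>sets M. \<exists>V\<in>sets N. \<exists>\<phi>.
        emeasure M (space M - U) = 0 \<and> emeasure N (space N - V) = 0 \<and>
        T ` U \<subseteq> U \<and> S ` V \<subseteq> V \<and>
        bij_betw \<phi> U V \<and>
        \<phi> \<in> restrict_space M U \<rightarrow>\<^sub>M restrict_space N V \<and>
        inv_into U \<phi> \<in> restrict_space N V \<rightarrow>\<^sub>M restrict_space M U \<and>
        distr (restrict_space M U) (restrict_space N V) \<phi> = restrict_space N V \<and>
        (\<forall>x\<in>U. \<phi> (T x) = S (\<phi> x)))"

section \<open>Kronecker transformations\<close>

definition topological_group :: "('g, 'c) monoid_scheme \<Rightarrow> 'g topology \<Rightarrow> bool" where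
  "topological_group G \<tau> \<longleftrightarrow>
     group G \<and> topspace \<tau> = carrier G \<and>
     continuous_map (prod_topology \<tau> \<tau>) \<tau> (\<lambda>(x, y). x \<otimes>\<^bsub>G\<^esub> y) \<and>
     continuous_map \<tau> \<tau> (\<lambda>x. inv\<^bsub>G\<^esub> x)"

text \<open>
  On a compact metrizable group every finite Borel measure is regular and left-invariant measures
  are right-invariant, so a Haar measure is a finite nonzero left-invariant Borel measure.
  Its total mass is fixed separately.
\<close>

definition Haar_measure ::
    "('g, 'c) monoid_scheme \<Rightarrow> 'g topology \<Rightarrow> 'g measure \<Rightarrow> bool" where
  "Haar_measure G \<tau> N \<longleftrightarrow>
     finite_measure N \<and> 0 < emeasure N (space N) \<and>
     space N = carrier G \<and> sets N = sigma_sets (carrier G) {U. openin \<tau> U} \<and>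
     (\<forall>h\<in>carrier G. \<forall>A\<in>sets N. emeasure N (h <#\<^bsub>G\<^esub> A) = emeasure N A)"

abbreviation (input) rotation :: "('g, 'c) monoid_scheme \<Rightarrow> 'g \<Rightarrow> 'g \<Rightarrow> 'g" where
  "rotation G g \<equiv> (\<lambda>h. g \<otimes>\<^bsub>G\<^esub> h)"

definition minimal_rotation ::
    "('g, 'c) monoid_scheme \<Rightarrow> 'g topology \<Rightarrow> 'g \<Rightarrow> bool" where
  "minimal_rotation G \<tau> g \<longleftrightarrow>
     (\<forall>h\<in>carrier G. \<tau> derived_set_of range (\<lambda>n. (rotation G g ^^ n) h) = carrier G)"

definition uniformly_rigid_rotation ::
    "('g, 'c) monoid_scheme \<Rightarrow> 'g topology \<Rightarrow> 'g \<Rightarrow> bool" where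
  "uniformly_rigid_rotation G \<tau> g \<longleftrightarrow>
     (\<exists>\<rho>. Metric_space (carrier G) \<rho> \<and> Metric_space.mtopology (carrier G) \<rho> = \<tau> \<and>
        (\<exists>k. filterlim k at_top sequentially \<and>
             uniform_limit (carrier G) (\<lambda>i h. \<rho> ((rotation G g ^^ k i) h) h)
               (\<lambda>_. 0) sequentially))"

definition Kronecker_rotation ::
    "('g, 'c) monoid_scheme \<Rightarrow> 'g topology \<Rightarrow> 'g \<Rightarrow> bool" where
  "Kronecker_rotation G \<tau> g \<longleftrightarrow>
     topological_group G \<tau> \<and> compact_space \<tau> \<and> metrizable_space \<tau> \<and> g \<in> carrier G \<and>
     minimal_rotation G \<tau> g \<and> uniformly_rigid_rotation G \<tau> g"

text \<open>
  Types cannot be quantified over inside a formula, so the groups below have their elements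
  labelled by real numbers; the topology \<open>\<tau>\<close> is arbitrary and unrelated to that of the reals.
  As compact metrizable spaces have at most the cardinality of the continuum, this is no loss of
  generality: see the lemma \<open>isomorphic_to_KroneckerI\<close>, where the group is over any type.
\<close>

definition isomorphic_to_Kronecker :: "'a measure \<Rightarrow> ('a \<Rightarrow> 'a) \<Rightarrow> bool" where
  "isomorphic_to_Kronecker M T \<longleftrightarrow>
     (\<exists>(G :: real monoid) \<tau> g N.
        Kronecker_rotation G \<tau> g \<and> Haar_measure G \<tau> N \<and>
        emeasure N (space N) = emeasure M (space M) \<and>
        isomorphic_mod_0 M T N (rotation G g))"

lemma compact_metrizable_embeds_real:
  fixes \<tau> :: "'g topology"
  assumes "compact_space \<tau>" "metrizable_space \<tau>"
  shows "\<exists>f :: 'g \<Rightarrow> real. inj_on f (topspace \<tau>)"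
proof -
  obtain X \<rho> where "Metric_space X \<rho>" and \<tau>: "\<tau> = Metric_space.mtopology X \<rho>"
    using assms(2) unfolding metrizable_space_def by blast
  then interpret Metric_space X \<rho> by simp
  have "compactin mtopology X"
    using assms(1) \<tau> by (simp add: compact_space_def)
  then have tb: "mtotally_bounded X"
    using compactin_imp_mtotally_bounded by blast
  have "\<exists>K. finite K \<and> K \<subseteq> X \<and> X \<subseteq> (\<Union>x\<in>K. mball x (1 / real (Suc n)))" for n
    using tb unfolding mtotally_bounded_def by simp
  then obtain K where K: "\<And>n. finite (K n)" "\<And>n. K n \<subseteq> X"
      "\<And>n. X \<subseteq> (\<Union>x\<in>K n. mball x (1 / real (Suc n)))"
    by metis
  define D where "D = (SIGMA n:UNIV. K n)"
  have "countable D"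
    unfolding D_def using K(1) by (intro countable_SIGMA) (auto intro: countable_finite)
  then obtain c :: "nat \<times> 'g \<Rightarrow> nat" where c: "inj_on c D"
    unfolding countable_def by blast
  define code where "code x = {(n, k) \<in> D. \<rho> k x < 1 / real (Suc n)}" for x
  have "inj_on code X"
  proof (rule inj_onI)
    fix x y assume xy: "x \<in> X" "y \<in> X" "code x = code y"
    show "x = y"
    proof (rule ccontr)
      assume "x \<noteq> y"
      then have "0 < \<rho> x y / 2"
        using xy by simp
      then obtain n where n: "1 / real (Suc n) < \<rho> x y / 2"
        using nat_approx_posE by blast
      obtain k where k: "k \<in> K n" "\<rho> k x < 1 / real (Suc n)"
        using K(3)[of n] xy(1) by auto
      then have "(n, k) \<in> code x"
        by (simp add: code_def D_def)
      then have "(n, k) \<in> code y"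
        using xy(3) by simp
      then have "\<rho> k y < 1 / real (Suc n)"
        by (simp add: code_def)
      moreover have "k \<in> X"
        using k(1) K(2) by blast
      then have "\<rho> x y \<le> \<rho> k x + \<rho> k y"
        using triangle[of x k y] commute[of x k] xy by simp
      ultimately show False
        using k(2) n by linarith
    qed
  qed
  moreover have "inj_on ((`) c) (code ` X)"
    by (rule inj_on_subset[OF inj_on_image_Pow[OF c]]) (auto simp: code_def)
  moreover obtain r :: "nat set \<Rightarrow> real" where "bij r"
    using nat_sets_eqpoll_reals unfolding eqpoll_def by blast
  ultimately have "inj_on (r \<circ> ((`) c \<circ> code)) X"
    by (intro comp_inj_on) (auto intro: inj_on_subset[OF bij_is_inj])
  then show ?thesis
    using \<tau> by auto
qed

lemma isomorphic_to_KroneckerI: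
  fixes G :: "('g, 'c) monoid_scheme"
  assumes rot: "Kronecker_rotation G \<tau> g" and haar: "Haar_measure G \<tau> N"
    and mass: "emeasure N (space N) = emeasure M (space M)"
    and iso: "isomorphic_mod_0 M T N (rotation G g)"
  shows "isomorphic_to_Kronecker M T"
proof -
  have tg: "topological_group G \<tau>" and comp: "compact_space \<tau>" and metr: "metrizable_space \<tau>"
    and g: "g \<in> carrier G" and min: "minimal_rotation G \<tau> g"
    and rigid: "uniformly_rigid_rotation G \<tau> g"
    using rot by (auto simp: Kronecker_rotation_def)
  have "group G" and top: "topspace \<tau> = carrier G"
    and mult: "continuous_map (prod_topology \<tau> \<tau>) \<tau> (\<lambda>(x, y). x \<otimes>\<^bsub>G\<^esub> y)"
    and cinv: "continuous_map \<tau> \<tau> (\<lambda>x. inv\<^bsub>G\<^esub> x)"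
    using tg by (auto simp: topological_group_def)
  interpret G: group G by fact
  obtain f :: "'g \<Rightarrow> real" where inj: "inj_on f (carrier G)"
    using compact_metrizable_embeds_real[OF comp metr] top by auto
  define C where "C = f ` carrier G"
  define j where "j = inv_into (carrier G) f"
  have jf [simp]: "j (f x) = x" if "x \<in> carrier G" for x
    using that inj by (simp add: j_def)
  have fj [simp]: "f (j y) = y" if "y \<in> C" for y
    using that by (simp add: j_def C_def f_inv_into_f)
  have jC [simp]: "j y \<in> carrier G" if "y \<in> C" for y
    using that by (auto simp: C_def)
  have fC [simp]: "f x \<in> C" if "x \<in> carrier G" for x
    using that by (simp add: C_def)
  have imj: "f ` A = j -` A \<inter> C" if "A \<subseteq> carrier G" for A
  proof (intro subset_antisym subsetI)
    fix y assume "y \<in> f ` A"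
    then show "y \<in> j -` A \<inter> C" using that by (auto dest: subsetD)
  next
    fix y assume y: "y \<in> j -` A \<inter> C"
    then have "j y \<in> A" "y = f (j y)" by simp_all
    then show "y \<in> f ` A" by blast
  qed
  define H :: "real monoid" where
    "H = \<lparr>carrier = C, mult = (\<lambda>x y. f (j x \<otimes>\<^bsub>G\<^esub> j y)), one = f \<one>\<^bsub>G\<^esub>\<rparr>"
  have H [simp]: "carrier H = C" "x \<otimes>\<^bsub>H\<^esub> y = f (j x \<otimes>\<^bsub>G\<^esub> j y)" "\<one>\<^bsub>H\<^esub> = f \<one>\<^bsub>G\<^esub>" for x y
    by (simp_all add: H_def)
  have "group H"
  proof (rule groupI)
    fix x assume x: "x \<in> carrier H"
    show "\<exists>y\<in>carrier H. y \<otimes>\<^bsub>H\<^esub> x = \<one>\<^bsub>H\<^esub>"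
      by (rule bexI[of _ "f (inv\<^bsub>G\<^esub> j x)"]) (use x in auto)
  qed (auto simp: G.m_assoc)
  then interpret H: group H .
  have Hinv: "inv\<^bsub>H\<^esub> x = f (inv\<^bsub>G\<^esub> j x)" if "x \<in> C" for x
    by (rule H.inv_equality) (use that in auto)
  define \<sigma> where "\<sigma> = pullback_topology C j \<tau>"
  have tops: "topspace \<sigma> = C"
    by (auto simp: \<sigma>_def topspace_pullback_topology top)
  have cj: "continuous_map \<sigma> \<tau> j"
    using continuous_map_pullback[of \<tau> \<tau> id C j] by (simp add: \<sigma>_def)
  have cf: "continuous_map \<tau> \<sigma> f"
    unfolding \<sigma>_def
  proof (rule continuous_map_pullback')
    show "continuous_map \<tau> \<tau> (j \<circ> f)"
      by (rule continuous_map_eq[OF continuous_map_id]) (simp add: top)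
    show "topspace \<tau> \<subseteq> f -` C"
      by (auto simp: top)
  qed
  have hms: "homeomorphic_maps \<tau> \<sigma> f j"
    unfolding homeomorphic_maps_def using cj cf by (simp add: top tops)
  then have hom: "homeomorphic_map \<tau> \<sigma> f"
    using homeomorphic_maps_map by blast
  have tgH: "topological_group H \<sigma>"
    unfolding topological_group_def
  proof (intro conjI)
    have "continuous_map (prod_topology \<sigma> \<sigma>) \<tau> (j \<circ> fst)" "continuous_map (prod_topology \<sigma> \<sigma>) \<tau> (j \<circ> snd)"
      by (rule continuous_map_compose[OF continuous_map_fst cj] continuous_map_compose[OF continuous_map_snd cj])+
    then have "continuous_map (prod_topology \<sigma> \<sigma>) (prod_topology \<tau> \<tau>) (\<lambda>p. (j (fst p), j (snd p)))"
      by (simp add: continuous_map_pairwise o_def)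
    then have "continuous_map (prod_topology \<sigma> \<sigma>) \<sigma>
        (f \<circ> ((\<lambda>(x, y). x \<otimes>\<^bsub>G\<^esub> y) \<circ> (\<lambda>p. (j (fst p), j (snd p)))))"
      by (rule continuous_map_compose[OF continuous_map_compose[OF _ mult] cf])
    then show "continuous_map (prod_topology \<sigma> \<sigma>) \<sigma> (\<lambda>(x, y). x \<otimes>\<^bsub>H\<^esub> y)"
      by (simp add: o_def case_prod_unfold)
    have "continuous_map \<sigma> \<sigma> (f \<circ> ((\<lambda>x. inv\<^bsub>G\<^esub> x) \<circ> j))"
      by (rule continuous_map_compose[OF continuous_map_compose[OF cj cinv] cf])
    then show "continuous_map \<sigma> \<sigma> (\<lambda>x. inv\<^bsub>H\<^esub> x)"
      by (rule continuous_map_eq) (simp add: tops Hinv)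
  qed (use \<open>group H\<close> tops in auto)
  have iterG: "(rotation G g ^^ n) h \<in> carrier G" if "h \<in> carrier G" for n h
    using that g by (induction n) auto
  have iter: "(rotation H (f g) ^^ n) (f h) = f ((rotation G g ^^ n) h)" if "h \<in> carrier G" for n h
    using that g iterG[OF that] by (induction n) auto
  have minH: "minimal_rotation H \<sigma> (f g)"
    unfolding minimal_rotation_def
  proof
    fix y assume "y \<in> carrier H"
    then obtain h where h: "h \<in> carrier G" "y = f h"
      by (auto simp: C_def)
    have "\<sigma> derived_set_of (f ` range (\<lambda>n. (rotation G g ^^ n) h))
        = f ` (\<tau> derived_set_of range (\<lambda>n. (rotation G g ^^ n) h))"
      by (rule homeomorphic_map_derived_set_of[OF hom]) (use iterG[OF h(1)] top in auto)
    also have "\<dots> = C"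
      using min h(1) by (simp add: minimal_rotation_def C_def)
    finally show "\<sigma> derived_set_of range (\<lambda>n. (rotation H (f g) ^^ n) y) = carrier H"
      by (simp only: h(2) iter[OF h(1)] image_image H(1))
  qed
  have rigidH: "uniformly_rigid_rotation H \<sigma> (f g)"
  proof -
    obtain \<rho> k where \<rho>: "Metric_space (carrier G) \<rho>" "Metric_space.mtopology (carrier G) \<rho> = \<tau>"
      and k: "filterlim k at_top sequentially"
        "uniform_limit (carrier G) (\<lambda>i h. \<rho> ((rotation G g ^^ k i) h) h) (\<lambda>_. 0) sequentially"
      using rigid unfolding uniformly_rigid_rotation_def by blast
    interpret A: Metric_space "carrier G" \<rho> by fact
    define \<rho>' where "\<rho>' x y = \<rho> (j x) (j y)" for x y
    interpret B: Metric_space C \<rho>'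
    proof
      show "\<rho>' x y = 0 \<longleftrightarrow> x = y" if "x \<in> C" "y \<in> C" for x y
        using that by (metis A.zero \<rho>'_def fj jC)
    qed (auto simp: \<rho>'_def A.commute intro: A.triangle)
    have ball: "B.mball (f x) r = f ` A.mball x r" if "x \<in> carrier G" for x r
      unfolding imj[OF A.mball_subset_mspace] using that by (auto simp: B.mball_def A.mball_def \<rho>'_def)
    have "openin B.mtopology S \<longleftrightarrow> openin \<sigma> S" for S
    proof (cases "S \<subseteq> C")
      case True
      then obtain S' where S': "S = f ` S'" "S' \<subseteq> carrier G"
        unfolding C_def by (metis subset_image_iff)
      have "openin \<sigma> S \<longleftrightarrow> openin \<tau> S'"
        using homeomorphic_map_openness[OF hom] S' top by simp
      also have "\<dots> \<longleftrightarrow> openin A.mtopology S'"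
        using \<rho>(2) by simp
      also have "\<dots> \<longleftrightarrow> (\<forall>x\<in>S'. \<exists>r>0. A.mball x r \<subseteq> S')"
        using S'(2) unfolding A.openin_mtopology by blast
      also have "\<dots> \<longleftrightarrow> (\<forall>x\<in>S'. \<exists>r>0. B.mball (f x) r \<subseteq> S)"
      proof (rule ball_cong[OF refl])
        fix x assume "x \<in> S'"
        then have x: "x \<in> carrier G" using S'(2) by blast
        have "B.mball (f x) r \<subseteq> S \<longleftrightarrow> A.mball x r \<subseteq> S'" for r
          unfolding ball[OF x] S'(1)
          by (rule inj_on_image_subset_iff[OF inj A.mball_subset_mspace S'(2)])
        then show "(\<exists>r>0. A.mball x r \<subseteq> S') \<longleftrightarrow> (\<exists>r>0. B.mball (f x) r \<subseteq> S)"
          by simp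
      qed
      also have "\<dots> \<longleftrightarrow> openin B.mtopology S"
        using True S'(1) unfolding B.openin_mtopology by blast
      finally show ?thesis by simp
    next
      case False
      then show ?thesis
        using openin_subset[of \<sigma> S] openin_subset[of B.mtopology S] tops by auto
    qed
    then have mt: "B.mtopology = \<sigma>"
      by (simp add: topology_eq)
    have "uniform_limit C (\<lambda>i y. \<rho>' ((rotation H (f g) ^^ k i) y) y) (\<lambda>_. 0) sequentially"
    proof (rule uniform_limitI)
      fix e :: real assume "e > 0"
      then have "\<forall>\<^sub>F i in sequentially. \<forall>h\<in>carrier G. dist (\<rho> ((rotation G g ^^ k i) h) h) 0 < e"
        using k(2) by (rule uniform_limitD[rotated])
      then show "\<forall>\<^sub>F i in sequentially. \<forall>y\<in>C. dist (\<rho>' ((rotation H (f g) ^^ k i) y) y) 0 < e"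
      proof (rule eventually_mono)
        fix i assume *: "\<forall>h\<in>carrier G. dist (\<rho> ((rotation G g ^^ k i) h) h) 0 < e"
        show "\<forall>y\<in>C. dist (\<rho>' ((rotation H (f g) ^^ k i) y) y) 0 < e"
        proof
          fix y assume "y \<in> C"
          then obtain h where h: "h \<in> carrier G" "y = f h" by (auto simp: C_def)
          show "dist (\<rho>' ((rotation H (f g) ^^ k i) y) y) 0 < e"
            unfolding h(2) iter[OF h(1)] \<rho>'_def using * h(1) iterG[OF h(1)] by simp
        qed
      qed
    qed
    then show ?thesis
      unfolding uniformly_rigid_rotation_def H(1)
      using mt k(1) B.Metric_space_axioms by blast
  qed
  have KH: "Kronecker_rotation H \<sigma> (f g)"
    unfolding Kronecker_rotation_def
    using tgH minH rigidH g comp metr homeomorphic_compact_space homeomorphic_metrizable_space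
      hms homeomorphic_maps_imp_homeomorphic_space by (metis H(1) fC)
  define N' where "N' = distr N (sigma C {U. openin \<sigma> U}) f"
  have finN: "finite_measure N" and posN: "0 < emeasure N (space N)"
    and spN: "space N = carrier G" and setsN: "sets N = sigma_sets (carrier G) {U. openin \<tau> U}"
    and transN: "\<And>h A. h \<in> carrier G \<Longrightarrow> A \<in> sets N \<Longrightarrow> emeasure N (h <#\<^bsub>G\<^esub> A) = emeasure N A"
    using haar by (auto simp: Haar_measure_def)
  have openC: "{U. openin \<sigma> U} \<subseteq> Pow C"
    using openin_subset tops by fastforce
  have spN': "space N' = C" and setsN': "sets N' = sigma_sets C {U. openin \<sigma> U}"
    using openC by (simp_all add: N'_def)
  have fm: "f \<in> N \<rightarrow>\<^sub>M sigma C {U. openin \<sigma> U}"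
  proof (rule measurable_measure_of[OF openC])
    show "f \<in> space N \<rightarrow> C" by (auto simp: spN)
    fix U assume "U \<in> {U. openin \<sigma> U}"
    then have "openin \<tau> (f -` U \<inter> carrier G)"
      using cf top openin_continuous_map_preimage[of \<tau> \<sigma> f U] by (simp add: vimage_def Int_def conj_commute)
    then show "f -` U \<inter> space N \<in> sets N"
      unfolding spN setsN by (intro sigma_sets.Basic) simp
  qed
  have setseq: "sets N' = sets (sigma C {U. openin \<sigma> U})"
    by (simp add: N'_def)
  have fm': "f \<in> N \<rightarrow>\<^sub>M N'"
    using fm measurable_cong_sets[OF refl setseq] by blast
  have jm: "j \<in> N' \<rightarrow>\<^sub>M N"
  proof (rule measurable_sigma_sets[OF setsN])
    show "{U. openin \<tau> U} \<subseteq> Pow (carrier G)"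
      using openin_subset top by fastforce
    show "j \<in> space N' \<rightarrow> carrier G" by (auto simp: spN')
    fix U assume "U \<in> {U. openin \<tau> U}"
    then have "openin \<sigma> (j -` U \<inter> C)"
      using cj tops openin_continuous_map_preimage[of \<sigma> \<tau> j U] by (simp add: vimage_def Int_def conj_commute)
    then show "j -` U \<inter> space N' \<in> sets N'"
      unfolding spN' setsN' by (intro sigma_sets.Basic) simp
  qed
  have emN': "emeasure N' A = emeasure N (f -` A \<inter> carrier G)" if "A \<in> sets N'" for A
    unfolding N'_def using emeasure_distr[OF fm, of A] that setseq spN by simp
  have vim: "f -` (f ` A) \<inter> carrier G = A" if "A \<subseteq> carrier G" for A
    using that inj by (auto dest: inj_onD)
  have fimg: "f ` A \<in> sets N'" if "A \<in> sets N" for A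
  proof -
    have "A \<subseteq> carrier G" using that sets.sets_into_space spN by blast
    then show ?thesis
      using measurable_sets[OF jm that] spN' imj by simp
  qed
  have emf: "emeasure N' (f ` A) = emeasure N A" if "A \<in> sets N" for A
    using emN'[OF fimg[OF that]] vim[of A] sets.sets_into_space[OF that] spN by simp
  have setN'E: "\<exists>A\<in>sets N. B = f ` A" if "B \<in> sets N'" for B
  proof
    show "f -` B \<inter> space N \<in> sets N" using fm' that by (rule measurable_sets)
    show "B = f ` (f -` B \<inter> space N)"
      using sets.sets_into_space[OF that] spN spN' by (auto simp: C_def)
  qed
  have massN': "emeasure N' (space N') = emeasure N (space N)"
    using emf[OF sets.top] spN spN' by (simp add: C_def)
  have haarH: "Haar_measure H \<sigma> N'"
    unfolding Haar_measure_def
  proof (intro conjI ballI)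
    show "finite_measure N'"
      using finN massN' by (intro finite_measureI) (simp add: finite_measure.emeasure_finite)
    fix h B assume h: "h \<in> carrier H" and "B \<in> sets N'"
    then obtain A where A: "A \<in> sets N" "B = f ` A" using setN'E by blast
    have sub: "A \<subseteq> carrier G" using A(1) sets.sets_into_space spN by blast
    have tr: "j h <#\<^bsub>G\<^esub> A \<in> sets N"
    proof -
      have jh: "j h \<in> carrier G" using h by simp
      have ct: "continuous_map \<tau> \<tau> (\<lambda>x. inv\<^bsub>G\<^esub> j h \<otimes>\<^bsub>G\<^esub> x)"
      proof -
        have "continuous_map \<tau> (prod_topology \<tau> \<tau>) (\<lambda>x. (inv\<^bsub>G\<^esub> j h, x))"
          using jh top by (auto simp: continuous_map_pairwise o_def)
        then have "continuous_map \<tau> \<tau> ((\<lambda>(x, y). x \<otimes>\<^bsub>G\<^esub> y) \<circ> (\<lambda>x. (inv\<^bsub>G\<^esub> j h, x)))"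
          by (rule continuous_map_compose[OF _ mult])
        then show ?thesis by (simp add: o_def)
      qed
      have "(\<lambda>x. inv\<^bsub>G\<^esub> j h \<otimes>\<^bsub>G\<^esub> x) \<in> N \<rightarrow>\<^sub>M N"
      proof (rule measurable_sigma_sets[OF setsN])
        show "{U. openin \<tau> U} \<subseteq> Pow (carrier G)"
          using openin_subset top by fastforce
        show "(\<lambda>x. inv\<^bsub>G\<^esub> j h \<otimes>\<^bsub>G\<^esub> x) \<in> space N \<rightarrow> carrier G" using jh spN by auto
        fix U assume "U \<in> {U. openin \<tau> U}"
        then have "openin \<tau> ((\<lambda>x. inv\<^bsub>G\<^esub> j h \<otimes>\<^bsub>G\<^esub> x) -` U \<inter> carrier G)"
          using openin_continuous_map_preimage[OF ct, of U] top
          by (simp add: vimage_def Int_def conj_commute)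
        then show "(\<lambda>x. inv\<^bsub>G\<^esub> j h \<otimes>\<^bsub>G\<^esub> x) -` U \<inter> space N \<in> sets N"
          unfolding spN setsN by (intro sigma_sets.Basic) simp
      qed
      then have "(\<lambda>x. inv\<^bsub>G\<^esub> j h \<otimes>\<^bsub>G\<^esub> x) -` A \<inter> space N \<in> sets N"
        using A(1) by (rule measurable_sets)
      also have "(\<lambda>x. inv\<^bsub>G\<^esub> j h \<otimes>\<^bsub>G\<^esub> x) -` A \<inter> space N = j h <#\<^bsub>G\<^esub> A"
      proof -
        have "x \<in> j h <#\<^bsub>G\<^esub> A" if "x \<in> carrier G" "inv\<^bsub>G\<^esub> j h \<otimes>\<^bsub>G\<^esub> x \<in> A" for x
          unfolding l_coset_def using that jh
          by (auto simp: G.m_assoc[symmetric] intro!: bexI[of _ "inv\<^bsub>G\<^esub> j h \<otimes>\<^bsub>G\<^esub> x"])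
        moreover have "x \<in> carrier G \<and> inv\<^bsub>G\<^esub> j h \<otimes>\<^bsub>G\<^esub> x \<in> A" if x: "x \<in> j h <#\<^bsub>G\<^esub> A" for x
        proof -
          obtain a where "a \<in> A" "x = j h \<otimes>\<^bsub>G\<^esub> a"
            using x by (auto simp: l_coset_def)
          moreover from this have "a \<in> carrier G" using sub by blast
          ultimately show ?thesis using jh by (simp add: G.m_assoc[symmetric])
        qed
        ultimately show ?thesis unfolding spN by blast
      qed
      finally show ?thesis .
    qed
    have "h <#\<^bsub>H\<^esub> B = f ` (j h <#\<^bsub>G\<^esub> A)"
      using sub by (force simp: l_coset_def A(2))
    then show "emeasure N' (h <#\<^bsub>H\<^esub> B) = emeasure N' B"
      using emf[OF tr] emf[OF A(1)] transN[OF _ A(1)] h A(2) by simp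
  qed (use massN' posN spN' setsN' in auto)
  have isoH: "isomorphic_mod_0 M T N' (rotation H (f g))"
  proof -
    obtain U V \<phi> where U: "U \<in> sets M" and V: "V \<in> sets N"
      and null: "emeasure M (space M - U) = 0" "emeasure N (space N - V) = 0"
      and TU: "T ` U \<subseteq> U" and SV: "rotation G g ` V \<subseteq> V" and bij: "bij_betw \<phi> U V"
      and m\<phi>: "\<phi> \<in> restrict_space M U \<rightarrow>\<^sub>M restrict_space N V"
      and mi: "inv_into U \<phi> \<in> restrict_space N V \<rightarrow>\<^sub>M restrict_space M U"
      and di: "distr (restrict_space M U) (restrict_space N V) \<phi> = restrict_space N V"
      and eq: "\<And>x. x \<in> U \<Longrightarrow> \<phi> (T x) = g \<otimes>\<^bsub>G\<^esub> \<phi> x"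
      using iso unfolding isomorphic_mod_0_def by blast
    have VG: "V \<subseteq> carrier G" using V sets.sets_into_space spN by blast
    have U\<phi>: "\<phi> x \<in> V" if "x \<in> U" for x using bij that bij_betwE by blast
    have bij': "bij_betw (f \<circ> \<phi>) U (f ` V)"
      using bij inj_on_imp_bij_betw[OF inj_on_subset[OF inj VG]] by (rule bij_betw_trans)
    have fV: "f ` V \<in> sets N'" by (rule fimg[OF V])
    have fr: "f \<in> restrict_space N V \<rightarrow>\<^sub>M restrict_space N' (f ` V)"
      using fm' by (rule measurable_restrict_space3) auto
    have jr: "j \<in> restrict_space N' (f ` V) \<rightarrow>\<^sub>M restrict_space N V"
      using jm by (rule measurable_restrict_space3) (use VG in auto)
    have di': "distr (restrict_space N V) (restrict_space N' (f ` V)) f = restrict_space N' (f ` V)"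
    proof (rule measure_eqI)
      fix B assume "B \<in> sets (distr (restrict_space N V) (restrict_space N' (f ` V)) f)"
      then have B: "B \<in> sets (restrict_space N' (f ` V))" by simp
      then have B': "B \<in> sets N'" "B \<subseteq> f ` V"
        using fV sets_restrict_space_iff[of "f ` V" N' B] by auto
      have *: "f -` B \<inter> space (restrict_space N V) = f -` B \<inter> carrier G"
      proof -
        have "x \<in> V" if x: "x \<in> carrier G" "f x \<in> B" for x
        proof -
          obtain v where "v \<in> V" "f x = f v" using B'(2) x(2) by blast
          then show ?thesis using inj_onD[OF inj, of x v] x(1) VG by blast
        qed
        then show ?thesis using VG by (auto simp: space_restrict_space spN)
      qed
      have "emeasure (distr (restrict_space N V) (restrict_space N' (f ` V)) f) B
          = emeasure (restrict_space N V) (f -` B \<inter> carrier G)"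
        using emeasure_distr[OF fr B] * by simp
      also have "\<dots> = emeasure N (f -` B \<inter> carrier G)"
        by (rule emeasure_restrict_space) (use * V in \<open>auto simp: space_restrict_space\<close>)
      also have "\<dots> = emeasure N' B" using emN' B' by simp
      also have "\<dots> = emeasure (restrict_space N' (f ` V)) B"
        using emeasure_restrict_space[of "f ` V" N' B] fV B' by simp
      finally show "emeasure (distr (restrict_space N V) (restrict_space N' (f ` V)) f) B
          = emeasure (restrict_space N' (f ` V)) B" .
    qed simp
    show ?thesis
      unfolding isomorphic_mod_0_def
    proof (intro bexI[OF _ U] bexI[OF _ fV] exI[of _ "f \<circ> \<phi>"] conjI ballI)
      have "space N' - f ` V = f ` (space N - V)"
        using VG inj by (auto simp: spN spN' C_def dest: inj_onD)
      then show "emeasure N' (space N' - f ` V) = 0"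
        using emf[of "space N - V"] V null(2) by simp
      show "rotation H (f g) ` f ` V \<subseteq> f ` V"
      proof (clarify)
        fix v assume v: "v \<in> V"
        then have "v \<in> carrier G" "g \<otimes>\<^bsub>G\<^esub> v \<in> V" using VG SV by auto
        then show "f g \<otimes>\<^bsub>H\<^esub> f v \<in> f ` V" using g by simp
      qed
      show "f \<circ> \<phi> \<in> restrict_space M U \<rightarrow>\<^sub>M restrict_space N' (f ` V)"
        using m\<phi> fr by (rule measurable_comp)
      have "inv_into U \<phi> \<circ> j \<in> restrict_space N' (f ` V) \<rightarrow>\<^sub>M restrict_space M U"
        using jr mi by (rule measurable_comp)
      moreover have "inv_into U (f \<circ> \<phi>) y = (inv_into U \<phi> \<circ> j) y"
        if y: "y \<in> space (restrict_space N' (f ` V))" for y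
      proof -
        obtain v where "v \<in> V" "y = f v" using y by (auto simp: space_restrict_space)
        moreover obtain u where "u \<in> U" "\<phi> u = v"
          using bij \<open>v \<in> V\<close> by (auto simp: bij_betw_def)
        moreover have "inv_into U (f \<circ> \<phi>) ((f \<circ> \<phi>) u) = u"
          using bij' \<open>u \<in> U\<close> by (intro inv_into_f_f) (auto simp: bij_betw_def)
        moreover have "inv_into U \<phi> (\<phi> u) = u"
          using bij \<open>u \<in> U\<close> by (intro inv_into_f_f) (auto simp: bij_betw_def)
        moreover have "v \<in> carrier G" using \<open>v \<in> V\<close> VG by blast
        ultimately show ?thesis by simp
      qed
      ultimately show "inv_into U (f \<circ> \<phi>) \<in> restrict_space N' (f ` V) \<rightarrow>\<^sub>M restrict_space M U"
        by (subst measurable_cong)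
      show "distr (restrict_space M U) (restrict_space N' (f ` V)) (f \<circ> \<phi>) = restrict_space N' (f ` V)"
        using distr_distr[OF fr m\<phi>] di di' by simp
      show "(f \<circ> \<phi>) (T x) = f g \<otimes>\<^bsub>H\<^esub> (f \<circ> \<phi>) x" if "x \<in> U" for x
      proof -
        have "\<phi> x \<in> carrier G" using U\<phi> VG that by blast
        then show ?thesis using eq[OF that] g by simp
      qed
    qed (use null TU bij' in auto)
  qed
  show ?thesis
    unfolding isomorphic_to_Kronecker_def
    using KH haarH isoH massN' mass by metis
qed

end

theory Submission
  imports Defs
begin

text \<open>
  Let \<open>D x y = sup\<^sub>n d (T\<^sup>n x) (T\<^sup>n y)\<close>, a metric that \<open>T\<close> does not expand. If sensitivity fails, then
  for every \<open>r\<close> the balls of \<open>D\<close>-radius \<open>r\<close> have positive measure at a set of centres of positive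
  measure. As \<open>x \<mapsto> \<mu> (B\<^sub>D x r)\<close> does not decrease along \<open>T\<close>, ergodicity bounds it below by a positive
  constant on a conull set \<open>X\<close>. Hence \<open>X\<close> is totally bounded for \<open>D\<close>, and almost every orbit is
  \<open>D\<close>-dense in it. A recurrent contraction is an isometry, so \<open>D (T\<^sup>a x\<^sub>0) (T\<^sup>b x\<^sub>0)\<close> depends only on
  \<open>\<bar>a - b\<bar>\<close> and defines a translation-invariant metric on the integers. The completion of the integers
  is a compact group \<open>K\<close> on which \<open>T\<close> becomes the rotation by 1, and the completion map \<open>X \<rightarrow> K\<close>
  is an isomorphism modulo null sets onto \<open>K\<close> with its Haar measure.
\<close>

section \<open>Compact groups with a dense cyclic subgroup\<close>

text \<open>\<open>T\<close> need not be invertible, so an orbit supplies only nonnegative times.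
  Negative times come from the isometry property, and recurrence makes the nonnegative integers
  dense in \<open>K\<close>. \<open>d\<close> is only a Borel function: its topology need not be the
  one behind the Borel structure of \<open>M\<close>. What survives is that \<open>D\<close> is a
  countable supremum of Borel functions, so measurability is reduced to distances from the countably
  many points of one orbit. \<open>X\<close> need not be complete for \<open>D\<close>, so the map
  into \<open>K\<close> is only injective in general. That its image is Borel with a Borel inverse
  is the Lusin-Souslin theorem; after discarding a null set, inner regularity gives enough of it.
  The image measure is invariant under the rotation by 1 alone, and the density of the multiples of
  1 turns this into invariance under all of \<open>K\<close>.\<close>

lemma continuous_eq_on_closure:
  fixes f g :: "'a::topological_space \<Rightarrow> 'b::metric_space"
  assumes "continuous_on (closure S) f" "continuous_on (closure S) g"
    and "\<And>x. x \<in> S \<Longrightarrow> f x = g x" "x \<in> closure S"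
  shows "f x = g x"
  using continuous_constant_on_closure[of S "\<lambda>x. dist (f x) (g x)" 0 x] assms
  by (auto intro: continuous_intros)

text \<open>The abstract form in which the orbit enters: a relatively compact copy of the integers
  with an invariant metric. Only \<open>recurrent\<close> singles out the positive direction; it
  yields both the density of forward orbits and the times of uniform rigidity.\<close>

locale translation_invariant_integers =
  fixes \<Phi> :: "int \<Rightarrow> 'e::complete_space"
  assumes inj: "inj \<Phi>"
    and dist_translate: "dist (\<Phi> (a + c)) (\<Phi> (b + c)) = dist (\<Phi> a) (\<Phi> b)"
    and compact: "compact (closure (range \<Phi>))"
    and recurrent: "0 < \<epsilon> \<Longrightarrow> \<exists>n\<ge>m. dist (\<Phi> (int n)) (\<Phi> 0) < \<epsilon>"
begin

abbreviation K :: "'e set" where "K \<equiv> closure (range \<Phi>)"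

lemma in_K [simp]: "\<Phi> a \<in> K"
  by (rule subsetD[OF closure_subset rangeI])

lemma dist_translate_left: "dist (\<Phi> (c + a)) (\<Phi> (c + b)) = dist (\<Phi> a) (\<Phi> b)"
  using dist_translate[of a c b] by (simp add: add.commute)

text \<open>Translation by \<open>a + b\<close> carries the pair \<open>- a\<close>,
  \<open>- b\<close> to \<open>b\<close>, \<open>a\<close>.\<close>

lemma dist_uminus: "dist (\<Phi> (- a)) (\<Phi> (- b)) = dist (\<Phi> a) (\<Phi> b)"
  using dist_translate[of "- a" "a + b" "- b"] by (simp add: dist_commute)

lemma forward_dense:
  assumes "x \<in> K" "0 < \<epsilon>"
  shows "\<exists>n. dist (\<Phi> (int n)) x < \<epsilon>"
proof -
  have "\<exists>y\<in>range \<Phi>. dist y x < \<epsilon> / 2"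
    using closure_approachable[of x "range \<Phi>"] assms half_gt_zero by blast
  then obtain a where a: "dist (\<Phi> a) x < \<epsilon> / 2"
    by blast
  \<comment> \<open>The approximating integer \<open>a\<close> may be negative; a return time beyond
    \<open>- a\<close> moves it to a nonnegative one at little cost.\<close>
  obtain n where n: "n \<ge> nat (- a)" "dist (\<Phi> (int n)) (\<Phi> 0) < \<epsilon> / 2"
    using recurrent[of "\<epsilon> / 2" "nat (- a)"] half_gt_zero[OF assms(2)] by blast
  have "dist (\<Phi> (int n + a)) (\<Phi> a) < \<epsilon> / 2"
    using n(2) dist_translate[of "int n" a 0] by (simp only: add_0)
  then have "dist (\<Phi> (int n + a)) x < \<epsilon>"
    using a dist_triangle[of "\<Phi> (int n + a)" x "\<Phi> a"] by linarith
  moreover have "int (nat (int n + a)) = int n + a"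
    using n(1) by arith
  ultimately have "dist (\<Phi> (int (nat (int n + a)))) x < \<epsilon>"
    by (simp only:)
  then show ?thesis by blast
qed

section \<open>Addition and negation extended to the completion\<close>

lemma mult_ex:
  "\<exists>m. continuous_on (K \<times> K) m \<and> (\<forall>a b. m (\<Phi> a, \<Phi> b) = \<Phi> (a + b))"
proof -
  define f where "f p = \<Phi> (inv_into UNIV \<Phi> (fst p) + inv_into UNIV \<Phi> (snd p))" for p
  have f: "f (\<Phi> a, \<Phi> b) = \<Phi> (a + b)" for a b
    using inj by (simp add: f_def)
  have "uniformly_continuous_on (range \<Phi> \<times> range \<Phi>) f"
    unfolding uniformly_continuous_on_def
  proof (intro allI impI)
    fix \<epsilon> :: real assume "0 < \<epsilon>"
    \<comment> \<open>Changing one summand at a time costs the displacement of that summand, and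
      each component moves by at most \<open>dist p q\<close>; hence
      \<open>\<epsilon> / 2\<close>.\<close>
    have "dist (f p) (f q) < \<epsilon>"
      if pq: "p \<in> range \<Phi> \<times> range \<Phi>" "q \<in> range \<Phi> \<times> range \<Phi>" "dist p q < \<epsilon> / 2" for p q
    proof -
      obtain a b a' b' where eq: "p = (\<Phi> a, \<Phi> b)" "q = (\<Phi> a', \<Phi> b')" using pq by auto
      have "dist (f p) (f q) \<le> dist (\<Phi> (a + b)) (\<Phi> (a' + b)) + dist (\<Phi> (a' + b)) (\<Phi> (a' + b'))"
        unfolding eq f by (rule dist_triangle)
      also have "\<dots> = dist (\<Phi> a) (\<Phi> a') + dist (\<Phi> b) (\<Phi> b')"
        using dist_translate[of a b a'] dist_translate[of b a' b'] by (simp add: add.commute)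
      also have "\<dots> < \<epsilon>"
        using dist_fst_le[of p q] dist_snd_le[of p q] pq(3) eq by simp
      finally show ?thesis .
    qed
    then show "\<exists>\<delta>>0. \<forall>p\<in>range \<Phi> \<times> range \<Phi>. \<forall>q\<in>range \<Phi> \<times> range \<Phi>. dist q p < \<delta> \<longrightarrow> dist (f q) (f p) < \<epsilon>"
      using \<open>0 < \<epsilon>\<close> by (intro exI[of _ "\<epsilon> / 2"]) auto
  qed
  then obtain m where m: "uniformly_continuous_on (closure (range \<Phi> \<times> range \<Phi>)) m"
    and mf: "\<And>x. x \<in> range \<Phi> \<times> range \<Phi> \<Longrightarrow> f x = m x"
    by (rule uniformly_continuous_on_extension_on_closure) (rule that, assumption)
  have "continuous_on (K \<times> K) m"
    using uniformly_continuous_imp_continuous[OF m] by (simp only: closure_Times)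
  moreover have "m (\<Phi> a, \<Phi> b) = \<Phi> (a + b)" for a b
    using mf[of "(\<Phi> a, \<Phi> b)"] f by simp
  ultimately show ?thesis by blast
qed

lemma uminus_ex:
  "\<exists>i. continuous_on K i \<and> (\<forall>a. i (\<Phi> a) = \<Phi> (- a))"
proof -
  define f where "f x = \<Phi> (- inv_into UNIV \<Phi> x)" for x
  have f: "f (\<Phi> a) = \<Phi> (- a)" for a
    using inj by (simp add: f_def)
  have "dist (f x) (f y) = dist x y" if "x \<in> range \<Phi>" "y \<in> range \<Phi>" for x y
    using that f dist_uminus by auto
  then have "uniformly_continuous_on (range \<Phi>) f"
    unfolding uniformly_continuous_on_def by metis
  then obtain i where i: "uniformly_continuous_on K i" and "\<And>x. x \<in> range \<Phi> \<Longrightarrow> f x = i x"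
    by (rule uniformly_continuous_on_extension_on_closure) (rule that, assumption)
  then have "i (\<Phi> a) = \<Phi> (- a)" for a
    using f[of a] by (metis rangeI)
  then show ?thesis
    using uniformly_continuous_imp_continuous[OF i] by blast
qed

text \<open>Continuity and the values on the dense set \<open>range \<Phi>\<close> determine the map
  on \<open>K \<times> K\<close>, so the choice is immaterial there.\<close>

definition add :: "'e \<times> 'e \<Rightarrow> 'e" where
  "add = (SOME m. continuous_on (K \<times> K) m \<and> (\<forall>a b. m (\<Phi> a, \<Phi> b) = \<Phi> (a + b)))"

definition neg :: "'e \<Rightarrow> 'e" where
  "neg = (SOME i. continuous_on K i \<and> (\<forall>a. i (\<Phi> a) = \<Phi> (- a)))"

lemma continuous_add: "continuous_on (K \<times> K) add"
  and add_\<Phi> [simp]: "add (\<Phi> a, \<Phi> b) = \<Phi> (a + b)"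
  using someI_ex[OF mult_ex] unfolding add_def[symmetric] by simp_all

lemma continuous_neg: "continuous_on K neg"
  and neg_\<Phi> [simp]: "neg (\<Phi> a) = \<Phi> (- a)"
  using someI_ex[OF uminus_ex] unfolding neg_def[symmetric] by simp_all

lemma closed_K: "closed K"
  by simp

lemma add_in_K [simp]:
  assumes "x \<in> K" "y \<in> K"
  shows "add (x, y) \<in> K"
proof -
  have "add ` closure (range \<Phi> \<times> range \<Phi>) \<subseteq> K"
    by (rule image_closure_subset) (auto simp: closure_Times continuous_add)
  then show ?thesis
    using assms by (auto simp: closure_Times)
qed

lemma neg_in_K [simp]:
  assumes "x \<in> K"
  shows "neg x \<in> K"
proof -
  have "neg ` K \<subseteq> K"
    by (rule image_closure_subset) (auto simp: continuous_neg)
  then show ?thesis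
    using assms by auto
qed

lemma continuous_on_add [continuous_intros]:
  assumes "continuous_on S f" "continuous_on S g" "f ` S \<subseteq> K" "g ` S \<subseteq> K"
  shows "continuous_on S (\<lambda>x. add (f x, g x))"
  by (rule continuous_on_compose2[OF continuous_add continuous_on_Pair[OF assms(1,2)]])
    (use assms in auto)

lemma continuous_on_neg [continuous_intros]:
  assumes "continuous_on S f" "f ` S \<subseteq> K"
  shows "continuous_on S (\<lambda>x. neg (f x))"
  by (rule continuous_on_compose2[OF continuous_neg assms])

text \<open>An identity between continuous expressions need only be checked on integers, by density.
  Three variables cover associativity and both invariance laws of the metric.\<close>

lemma eq_on_K3:
  fixes F H :: "'e \<times> 'e \<times> 'e \<Rightarrow> 'm::metric_space"
  assumes "continuous_on (K \<times> K \<times> K) F" "continuous_on (K \<times> K \<times> K) H"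
    and "\<And>a b c. F (\<Phi> a, \<Phi> b, \<Phi> c) = H (\<Phi> a, \<Phi> b, \<Phi> c)"
    and "x \<in> K" "y \<in> K" "z \<in> K"
  shows "F (x, y, z) = H (x, y, z)"
proof (rule continuous_eq_on_closure[where S = "range \<Phi> \<times> range \<Phi> \<times> range \<Phi>"])
  have *: "closure (range \<Phi> \<times> range \<Phi> \<times> range \<Phi>) = K \<times> K \<times> K"
    by (simp add: closure_Times)
  show "continuous_on (closure (range \<Phi> \<times> range \<Phi> \<times> range \<Phi>)) F"
    "continuous_on (closure (range \<Phi> \<times> range \<Phi> \<times> range \<Phi>)) H"
    "(x, y, z) \<in> closure (range \<Phi> \<times> range \<Phi> \<times> range \<Phi>)"
    unfolding * using assms by auto
  show "F p = H p" if "p \<in> range \<Phi> \<times> range \<Phi> \<times> range \<Phi>" for p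
    using that assms(3) by auto
qed

lemma add_assoc:
  assumes "x \<in> K" "y \<in> K" "z \<in> K"
  shows "add (add (x, y), z) = add (x, add (y, z))"
proof -
  have "continuous_on (K \<times> K \<times> K) (\<lambda>p. add (add (fst p, fst (snd p)), snd (snd p)))"
    by (intro continuous_on_add continuous_on_fst continuous_on_snd continuous_on_id)
      (auto simp del: prod.collapse)
  moreover have "continuous_on (K \<times> K \<times> K) (\<lambda>p. add (fst p, add (fst (snd p), snd (snd p))))"
    by (intro continuous_on_add continuous_on_fst continuous_on_snd continuous_on_id)
      (auto simp del: prod.collapse)
  ultimately show ?thesis
    using eq_on_K3[OF _ _ _ assms, of "\<lambda>p. add (add (fst p, fst (snd p)), snd (snd p))"
        "\<lambda>p. add (fst p, add (fst (snd p), snd (snd p)))"]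
    by (simp add: add.assoc del: prod.collapse)
qed

lemma dist_add:
  assumes "x \<in> K" "y \<in> K" "z \<in> K"
  shows "dist (add (x, y)) (add (x, z)) = dist y z"
proof -
  have "continuous_on (K \<times> K \<times> K) (\<lambda>p. dist (add (fst p, fst (snd p))) (add (fst p, snd (snd p))))"
    by (intro continuous_on_dist continuous_on_add continuous_on_fst continuous_on_snd continuous_on_id)
      (auto simp del: prod.collapse)
  moreover have "continuous_on (K \<times> K \<times> K) (\<lambda>p. dist (fst (snd p)) (snd (snd p)))"
    by (intro continuous_intros)
  ultimately show ?thesis
    using eq_on_K3[OF _ _ _ assms, of "\<lambda>p. dist (add (fst p, fst (snd p))) (add (fst p, snd (snd p)))"
        "\<lambda>p. dist (fst (snd p)) (snd (snd p))"]
    by (simp add: dist_translate_left del: prod.collapse)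
qed

lemma add_zero:
  assumes "x \<in> K"
  shows "add (\<Phi> 0, x) = x"
  by (rule continuous_eq_on_closure[OF _ _ _ assms]) (auto intro!: continuous_intros)

lemma add_neg:
  assumes "x \<in> K"
  shows "add (neg x, x) = \<Phi> 0"
  by (rule continuous_eq_on_closure[OF _ _ _ assms]) (auto intro!: continuous_intros)

definition G :: "'e monoid" where
  "G = \<lparr>carrier = K, mult = (\<lambda>x y. add (x, y)), one = \<Phi> 0\<rparr>"

lemma G_simps [simp]: "carrier G = K" "x \<otimes>\<^bsub>G\<^esub> y = add (x, y)" "\<one>\<^bsub>G\<^esub> = \<Phi> 0"
  by (simp_all add: G_def)

lemma group_G: "group G"
proof (rule groupI)
  show "\<exists>y\<in>carrier G. y \<otimes>\<^bsub>G\<^esub> x = \<one>\<^bsub>G\<^esub>" if "x \<in> carrier G" for x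
    by (rule bexI[of _ "neg x"]) (use that in \<open>simp_all add: add_neg\<close>)
qed (simp_all add: add_assoc add_zero)

sublocale group G
  by (rule group_G)

lemma inv_G [simp]: "x \<in> K \<Longrightarrow> inv\<^bsub>G\<^esub> x = neg x"
  by (rule inv_equality) (auto simp: add_neg)

lemma topological_group_G: "topological_group G (top_of_set K)"
  unfolding topological_group_def
proof (intro conjI)
  show "continuous_map (prod_topology (top_of_set K) (top_of_set K)) (top_of_set K) (\<lambda>(x, y). x \<otimes>\<^bsub>G\<^esub> y)"
    using continuous_add by (auto simp: prod_topology_subtopology_eu)
  show "continuous_map (top_of_set K) (top_of_set K) (\<lambda>x. inv\<^bsub>G\<^esub> x)"
    by (rule continuous_map_eq[of _ _ neg]) (auto simp: continuous_neg)
qed (auto simp: group_G)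

section \<open>The rotation by 1 is minimal and uniformly rigid\<close>

lemma rotation_funpow:
  assumes "h \<in> K"
  shows "(rotation G (\<Phi> 1) ^^ n) h = add (\<Phi> (int n), h)"
proof (induction n)
  case (Suc n)
  then show ?case
    using add_assoc[of "\<Phi> 1" "\<Phi> (int n)" h] assms by simp
qed (simp add: add_zero assms)

lemma dist_add_right:
  assumes "x \<in> K" "y \<in> K" "z \<in> K"
  shows "dist (add (y, x)) (add (z, x)) = dist y z"
proof -
  have "continuous_on (K \<times> K \<times> K) (\<lambda>p. dist (add (fst (snd p), fst p)) (add (snd (snd p), fst p)))"
    by (intro continuous_on_dist continuous_on_add continuous_on_fst continuous_on_snd continuous_on_id)
      (auto simp del: prod.collapse)
  moreover have "continuous_on (K \<times> K \<times> K) (\<lambda>p. dist (fst (snd p)) (snd (snd p)))"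
    by (intro continuous_intros)
  ultimately show ?thesis
    using eq_on_K3[OF _ _ _ assms, of "\<lambda>p. dist (add (fst (snd p), fst p)) (add (snd (snd p), fst p))"
        "\<lambda>p. dist (fst (snd p)) (snd (snd p))"]
    by (simp add: dist_translate del: prod.collapse)
qed

text \<open>By invariance a translation displaces all points equally, so closeness to the identity
  need only be tested at \<open>\<Phi> 0\<close>.\<close>

lemma dist_rotation:
  assumes "h \<in> K"
  shows "dist (add (\<Phi> a, h)) h = dist (\<Phi> a) (\<Phi> 0)"
  using dist_add_right[of h "\<Phi> a" "\<Phi> 0"] by (simp add: add_zero assms)

lemma minimal_rotation_G: "minimal_rotation G (top_of_set K) (\<Phi> 1)"
  unfolding minimal_rotation_def
proof
  fix h assume "h \<in> carrier G"
  then have h: "h \<in> K" by simp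
  have range: "range (\<lambda>n. (rotation G (\<Phi> 1) ^^ n) h) = range (\<lambda>n. add (\<Phi> (int n), h))"
    using rotation_funpow[OF h] by simp
  have "\<exists>y. y \<noteq> k \<and> y \<in> range (\<lambda>n. add (\<Phi> (int n), h)) \<and> y \<in> U"
    if k: "k \<in> K" "k \<in> U" and U: "openin (top_of_set K) U" for k U
  proof -
    obtain \<epsilon> where \<epsilon>: "0 < \<epsilon>" "\<And>y. y \<in> K \<Longrightarrow> dist y k < \<epsilon> \<Longrightarrow> y \<in> U"
      using U k(2) unfolding openin_euclidean_subtopology_iff by blast
    \<comment> \<open>A time \<open>n\<close> with \<open>\<Phi> (int n)\<close> near the difference
      of \<open>k\<close> and \<open>h\<close> brings the orbit of \<open>h\<close> near
      \<open>k\<close>.\<close>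
    have "add (k, neg h) \<in> K" using k h by simp
    then obtain n where n: "dist (\<Phi> (int n)) (add (k, neg h)) < \<epsilon>"
      using forward_dense \<epsilon>(1) by blast
    have "add (add (k, neg h), h) = add (k, \<Phi> 0)"
      using k h by (simp add: add_assoc add_neg)
    also have "\<dots> = k" using r_one[of k] k by simp
    finally have near: "dist (add (\<Phi> (int n), h)) k < \<epsilon>"
      using dist_add_right[of h "\<Phi> (int n)" "add (k, neg h)"] n k h by simp
    show ?thesis
    proof (cases "add (\<Phi> (int n), h) = k")
      case False
      then show ?thesis using near \<epsilon>(2) h by (intro exI[of _ "add (\<Phi> (int n), h)"]) simp
    next
      case True
      \<comment> \<open>An accumulation point needs orbit points different from \<open>k\<close>. If
        the orbit hits \<open>k\<close> exactly, it is followed for one more return time, which is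
        positive and hence leaves \<open>k\<close> by injectivity of \<open>\<Phi>\<close>.\<close>
      obtain m where m: "m \<ge> 1" "dist (\<Phi> (int m)) (\<Phi> 0) < \<epsilon>"
        using recurrent[OF \<epsilon>(1)] by blast
      define y where "y = add (\<Phi> (int (m + n)), h)"
      have "y = add (\<Phi> (int m), k)"
        using add_assoc[of "\<Phi> (int m)" "\<Phi> (int n)" h] h True by (simp add: y_def)
      then have "dist y k = dist (\<Phi> (int m)) (\<Phi> 0)"
        using dist_rotation[OF k(1)] by simp
      moreover have "\<Phi> (int m) \<noteq> \<Phi> 0"
        using inj_eq[OF inj] m(1) by simp
      ultimately have "y \<noteq> k" "dist y k < \<epsilon>"
        using m(2) by auto
      moreover have "y \<in> K" using h by (simp add: y_def)
      moreover have "y \<in> range (\<lambda>n. add (\<Phi> (int n), h))"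
        unfolding y_def by (rule rangeI)
      ultimately show ?thesis
        using \<epsilon>(2) by blast
    qed
  qed
  then show "top_of_set K derived_set_of range (\<lambda>n. (rotation G (\<Phi> 1) ^^ n) h) = carrier G"
    unfolding range by (auto simp: derived_set_of_def)
qed

lemma uniformly_rigid_rotation_G: "uniformly_rigid_rotation G (top_of_set K) (\<Phi> 1)"
proof -
  interpret Submetric UNIV "dist :: 'e \<Rightarrow> 'e \<Rightarrow> real" K
    by unfold_locales (auto simp: dist_commute dist_triangle)
  \<comment> \<open>Asking for \<open>n \<ge> i\<close> makes the chosen times tend to infinity;
    uniformity in \<open>h\<close> will come from \<open>dist_rotation\<close>.\<close>
  have "\<exists>n\<ge>i. dist (\<Phi> (int n)) (\<Phi> 0) < 1 / real (Suc i)" for i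
    using recurrent[of "1 / real (Suc i)" i] by auto
  then obtain k where k: "\<And>i. i \<le> k i" "\<And>i. dist (\<Phi> (int (k i))) (\<Phi> 0) < 1 / real (Suc i)"
    by metis
  have "filterlim k at_top sequentially"
    by (rule filterlim_at_top_mono[OF filterlim_ident]) (simp add: k)
  moreover have "uniform_limit K (\<lambda>i h. dist ((rotation G (\<Phi> 1) ^^ k i) h) h) (\<lambda>_. 0) sequentially"
  proof (rule uniform_limitI)
    fix \<epsilon> :: real assume "0 < \<epsilon>"
    then have "\<forall>\<^sub>F i in sequentially. 1 / real (Suc i) < \<epsilon>"
      using LIMSEQ_Suc[OF lim_1_over_n] by (rule order_tendstoD(2)[rotated])
    then show "\<forall>\<^sub>F i in sequentially. \<forall>h\<in>K. dist (dist ((rotation G (\<Phi> 1) ^^ k i) h) h) 0 < \<epsilon>"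
    proof eventually_elim
      case (elim i)
      then show ?case
        using k(2)[of i] by (simp add: rotation_funpow dist_rotation del: G_simps of_nat_Suc)
    qed
  qed
  moreover have "sub.mtopology = top_of_set K"
    using mtopology_submetric by simp
  ultimately show ?thesis
    unfolding uniformly_rigid_rotation_def G_simps(1) using sub.Metric_space_axioms
    by (intro exI[of _ dist] conjI exI[of _ k]) assumption+
qed

lemma Kronecker_rotation_G: "Kronecker_rotation G (top_of_set K) (\<Phi> 1)"
  unfolding Kronecker_rotation_def
  using topological_group_G minimal_rotation_G uniformly_rigid_rotation_G compact
  by (simp add: compact_space_subtopology metrizable_space_subtopology metrizable_space_euclidean)

section \<open>Borel sets of \<open>K\<close> and Haar measure\<close>

lemma sets_restrict_borel_K: "sets (restrict_space borel K) = sigma_sets K {F. closed F \<and> F \<subseteq> K}"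
proof -
  have "sets (restrict_space borel K) = (\<inter>) K ` sigma_sets UNIV (Collect closed)"
    by (simp add: sets_restrict_space borel_eq_closed)
  also have "\<dots> = sigma_sets K ((\<inter>) K ` Collect closed)"
    by (rule sigma_sets_Int) (auto intro: sigma_sets.Basic)
  also have "(\<inter>) K ` Collect closed = {F. closed F \<and> F \<subseteq> K}"
    by (force intro: image_eqI[of _ _ "_ :: 'e set"])
  finally show ?thesis .
qed

text \<open>The generator in the form that \<open>Haar_measure\<close> asks for; the closed sets of
  the previous lemma are the generator on which measures get compared.\<close>

lemma sets_restrict_borel_K_open: "sets (restrict_space borel K) = sigma_sets K {U. openin (top_of_set K) U}"
proof -
  have "sets (restrict_space borel K) = (\<inter>) K ` sigma_sets UNIV (Collect open)"
    by (simp add: sets_restrict_space borel_def)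
  also have "\<dots> = sigma_sets K ((\<inter>) K ` Collect open)"
  proof (rule sigma_sets_Int)
    have "UNIV - (- K) \<in> sigma_sets UNIV (Collect open)"
      by (intro sigma_sets.Compl sigma_sets.Basic) (simp add: open_Compl)
    then show "K \<in> sigma_sets UNIV (Collect open)"
      by (simp add: Compl_eq_Diff_UNIV[symmetric])
  qed simp
  also have "(\<inter>) K ` Collect open = {U. openin (top_of_set K) U}"
    by (auto simp: openin_open)
  finally show ?thesis .
qed

text \<open>Invariance under the translation by 1 passes to all its nonnegative multiples, which are
  dense. For a limit \<open>h\<close> of these, a closed set can only gain measure in comparison
  with its preimage; applying this to the inverse of \<open>h\<close> as well gives equality, and
  the closed sets determine a finite measure.\<close>

lemma Haar_measureI:
  assumes fin: "finite_measure N" and pos: "0 < emeasure N (space N)"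
    and sets: "sets N = sets (restrict_space borel K)"
    and invar: "\<And>A. A \<in> sets N \<Longrightarrow> emeasure N ((\<lambda>x. add (\<Phi> 1, x)) -` A \<inter> K) = emeasure N A"
  shows "Haar_measure G (top_of_set K) N"
proof -
  interpret N: finite_measure N by (rule fin)
  define t where "t h x = add (h, x)" for h x
  have space: "space N = K"
    using sets_eq_imp_space_eq[OF sets] by (simp add: space_restrict_space)
  have closed_sets: "F \<in> sets N" if "closed F" "F \<subseteq> K" for F
    unfolding sets sets_restrict_borel_K using that by (intro sigma_sets.Basic) simp
  have tK: "t h x \<in> K" if "h \<in> K" "x \<in> K" for h x
    using that by (simp add: t_def)
  have t_measurable: "t h \<in> N \<rightarrow>\<^sub>M N" if "h \<in> K" for h
  proof -
    have "continuous_on K (t h)"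
      unfolding t_def using that by (intro continuous_intros) auto
    then have "t h \<in> restrict_space borel K \<rightarrow>\<^sub>M restrict_space borel K"
      by (intro measurable_restrict_space2 borel_measurable_continuous_on_restrict)
        (auto simp: space_restrict_space tK that)
    then show ?thesis
      using measurable_cong_sets[OF sets sets] by blast
  qed
  have t_\<Phi>: "emeasure N (t (\<Phi> (int n)) -` A \<inter> K) = emeasure N A" if A: "A \<in> sets N" for n A
  proof (induction n)
    case 0
    have "t (\<Phi> (int 0)) -` A \<inter> K = A"
      using sets.sets_into_space[OF A] space by (auto simp: t_def add_zero)
    then show ?case by simp
  next
    case (Suc n)
    have "t (\<Phi> (int (Suc n))) x = t (\<Phi> (int n)) (add (\<Phi> 1, x))" if "x \<in> K" for x
      using add_assoc[of "\<Phi> (int n)" "\<Phi> 1" x] that by (simp add: t_def add.commute)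
    then have "t (\<Phi> (int (Suc n))) -` A \<inter> K = (\<lambda>x. add (\<Phi> 1, x)) -` (t (\<Phi> (int n)) -` A \<inter> K) \<inter> K"
      by auto
    moreover have "t (\<Phi> (int n)) -` A \<inter> K \<in> sets N"
      using measurable_sets[OF t_measurable A] space by simp
    ultimately show ?case
      using invar Suc.IH by (simp only:)
  qed
  have le: "emeasure N (t h -` F \<inter> K) \<le> emeasure N F"
    if h: "h \<in> K" and F: "closed F" "F \<subseteq> K" for h F
  proof (cases "F = {}")
    case False
    \<comment> \<open>Closed neighbourhoods of \<open>F\<close> that shrink to it. This needs
      \<open>F\<close> nonempty, as \<open>infdist\<close> to the empty set is 0.\<close>
    define B where "B k = {y \<in> K. infdist y F \<le> 1 / real (Suc k)}" for k
    have B: "B k \<in> sets N" for k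
    proof (rule closed_sets)
      show "closed (B k)"
      proof -
        have "closed (K \<inter> (\<lambda>y. infdist y F) -` {..1 / real (Suc k)})"
          by (intro continuous_closed_preimage continuous_on_infdist continuous_on_id closed_K closed_atMost)
        then show ?thesis by (simp add: B_def Int_def vimage_def)
      qed
    qed (auto simp: B_def)
    have "decseq B"
      unfolding decseq_def
    proof (intro allI impI subsetI)
      fix m n :: nat and y assume "m \<le> n" "y \<in> B n"
      moreover from \<open>m \<le> n\<close> have "1 / real (Suc n) \<le> 1 / real (Suc m)"
        by (intro frac_le) auto
      ultimately show "y \<in> B m"
        unfolding B_def by (auto intro: order_trans)
    qed
    then have lim: "(\<lambda>k. emeasure N (B k)) \<longlonglongrightarrow> emeasure N (\<Inter>k. B k)"
      using B by (intro Lim_emeasure_decseq) auto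
    have "(\<Inter>k. B k) = F"
    proof (intro equalityI subsetI)
      fix y assume y: "y \<in> (\<Inter>k. B k)"
      have "infdist y F \<le> 0"
      proof (rule ccontr)
        assume "\<not> infdist y F \<le> 0"
        then obtain k where "1 / real (Suc k) < infdist y F"
          using nat_approx_posE by (metis not_le)
        moreover have "infdist y F \<le> 1 / real (Suc k)"
          using y unfolding B_def by blast
        ultimately show False by linarith
      qed
      then show "y \<in> F"
        using in_closed_iff_infdist_zero[OF F(1) False] infdist_nonneg[of y F] by simp
    next
      fix y assume "y \<in> F"
      then show "y \<in> (\<Inter>k. B k)"
        using F(2) by (auto simp: B_def)
    qed
    moreover have "emeasure N (t h -` F \<inter> K) \<le> emeasure N (B k)" for k
    proof -
      \<comment> \<open>An integer translation this close to \<open>h\<close> sends into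
        \<open>B k\<close> every point that \<open>t h\<close> sends into \<open>F\<close>, and its
        invariance is already known.\<close>
      obtain n where n: "dist (\<Phi> (int n)) h < 1 / real (Suc k)"
        using forward_dense[OF h, of "1 / real (Suc k)"] by auto
      have "t h -` F \<inter> K \<subseteq> t (\<Phi> (int n)) -` B k \<inter> K"
      proof
        fix x assume x: "x \<in> t h -` F \<inter> K"
        then have "infdist (t (\<Phi> (int n)) x) F \<le> dist (t (\<Phi> (int n)) x) (t h x)"
          by (intro infdist_le) simp
        also have "\<dots> = dist (\<Phi> (int n)) h"
          unfolding t_def using x h by (intro dist_add_right) auto
        finally show "x \<in> t (\<Phi> (int n)) -` B k \<inter> K"
          using n x tK by (simp add: B_def)
      qed
      then have "emeasure N (t h -` F \<inter> K) \<le> emeasure N (t (\<Phi> (int n)) -` B k \<inter> K)"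
        using measurable_sets[OF t_measurable B] space by (intro emeasure_mono) auto
      then show ?thesis using t_\<Phi>[OF B] by simp
    qed
    ultimately show ?thesis
      using LIMSEQ_le_const[OF lim] by auto
  qed simp
  have t_closed: "closed (t h -` F \<inter> K)" if "h \<in> K" "closed F" for h F
  proof -
    have "continuous_on K (t h)"
      unfolding t_def using that(1) by (intro continuous_intros) auto
    then have "closed (K \<inter> t h -` F)"
      using that(2) by (intro continuous_closed_preimage) auto
    then show ?thesis by (simp add: Int_commute)
  qed
  have eq: "emeasure N (t h -` F \<inter> K) = emeasure N F"
    if h: "h \<in> K" and F: "closed F" "F \<subseteq> K" for h F
  proof (rule antisym[OF le[OF that]])
    \<comment> \<open>The reverse inequality is the same one for the inverse translation, applied to
      the preimage of \<open>F\<close>.\<close>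
    have "t h (t (neg h) x) = x" if "x \<in> K" for x
      using add_assoc[of h "neg h" x] r_inv[of h] h that by (simp add: t_def add_zero)
    then have "t (neg h) -` (t h -` F \<inter> K) \<inter> K = F"
      using F(2) h tK by auto
    then show "emeasure N F \<le> emeasure N (t h -` F \<inter> K)"
      using le[of "neg h" "t h -` F \<inter> K"] t_closed[OF h F(1)] h by simp
  qed
  have t_invar: "emeasure N (t h -` A \<inter> K) = emeasure N A" if h: "h \<in> K" and A: "A \<in> sets N" for h A
  proof -
    have "distr N N (t h) = N"
    proof (rule measure_eqI_generator_eq[where A = "\<lambda>_. K"])
      show "Int_stable {F. closed F \<and> F \<subseteq> K}"
        by (auto simp: Int_stable_def)
      show "emeasure (distr N N (t h)) F = emeasure N F" if "F \<in> {F. closed F \<and> F \<subseteq> K}" for F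
        using that eq[OF h] emeasure_distr[OF t_measurable[OF h] closed_sets] space by simp
      show "emeasure (distr N N (t h)) K \<noteq> \<infinity>"
        using emeasure_distr[OF t_measurable[OF h] closed_sets[of K]] by simp
    qed (auto simp: sets sets_restrict_borel_K)
    then show ?thesis
      using emeasure_distr[OF t_measurable[OF h] A] space by simp
  qed
  have "emeasure N (h <#\<^bsub>G\<^esub> A) = emeasure N A" if h: "h \<in> K" and A: "A \<in> sets N" for h A
  proof -
    have sub: "A \<subseteq> K" using sets.sets_into_space[OF A] space by simp
    have 1: "t (neg h) (t h x) = x" if "x \<in> K" for x
      using add_assoc[of "neg h" h x] h that by (simp add: t_def add_zero add_neg)
    have 2: "t h (t (neg h) x) = x" if "x \<in> K" for x
      using add_assoc[of h "neg h" x] r_inv[of h] h that by (simp add: t_def add_zero)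
    have "h <#\<^bsub>G\<^esub> A = t h ` A"
      by (auto simp: l_coset_def t_def)
    \<comment> \<open>Invariance was obtained for preimages, whereas cosets are images; the inverse
      translation mediates.\<close>
    also have "\<dots> = t (neg h) -` A \<inter> K"
    proof (intro equalityI subsetI)
      fix y assume "y \<in> t h ` A"
      then obtain x where x: "x \<in> A" "y = t h x" by blast
      then have "x \<in> K" using sub by blast
      then show "y \<in> t (neg h) -` A \<inter> K"
        using 1 x tK[OF h] by simp
    next
      fix y assume "y \<in> t (neg h) -` A \<inter> K"
      then have "y = t h (t (neg h) y)" "t (neg h) y \<in> A" using 2 by simp_all
      then show "y \<in> t h ` A" by (rule image_eqI)
    qed
    finally show ?thesis
      using t_invar[OF _ A] h by simp
  qed
  then show ?thesis
    unfolding Haar_measure_def using fin pos space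
    by (simp add: sets sets_restrict_borel_K_open)
qed

end

section \<open>Injective Borel maps are isomorphisms modulo null sets\<close>

text \<open>Distances to a dense sequence embed a Polish space into the real sequences. As the image
  is Borel, the abstract space can be traded for a Borel subset of a concrete Polish space, where
  regularity of measures is available.\<close>

lemma standard_Borel_embedding:
  assumes "standard_Borel M"
  obtains e :: "'a \<Rightarrow> nat \<Rightarrow> real" where
    "e \<in> borel_measurable M" "inj_on e (space M)" "e ` space M \<in> sets borel"
    "\<And>S. S \<in> sets M \<Longrightarrow> \<exists>B\<in>sets borel. S = e -` B \<inter> space M"
proof (cases "space M = {}")
  case True
  then show thesis
    by (intro that[of "\<lambda>_ _. 0"]) (auto simp: measurable_def dest: sets.sets_into_space intro!: bexI[of _ "{}"])
next
  case False
  obtain \<tau> where \<tau>: "completely_metrizable_space \<tau>" "second_countable \<tau>" "topspace \<tau> = space M"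
    "sets M = sigma_sets (space M) {U. openin \<tau> U}"
    using assms unfolding standard_Borel_def by blast
  obtain X m where "Metric_space X m" and complete: "Metric_space.mcomplete X m"
    and \<tau>_eq: "\<tau> = Metric_space.mtopology X m"
    using \<tau>(1) unfolding completely_metrizable_space_def by blast
  then interpret Metric_space X m by simp
  have X: "space M = X" using \<tau>(3) \<tau>_eq by simp
  obtain C where C: "countable C" "C \<subseteq> X" "mtopology closure_of C = X"
    using second_countable_imp_separable_space[OF \<tau>(2)] \<tau>_eq
    unfolding separable_space_def by auto
  have "C \<noteq> {}" using C(3) False X by auto
  define x where "x = from_nat_into C"
  have xC: "range x = C"
    using C(1) \<open>C \<noteq> {}\<close> unfolding x_def by (rule range_from_nat_into[rotated])
  then have xX [simp]: "x i \<in> X" for i using C(2) by auto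
  have dense: "\<exists>i. m p (x i) < \<epsilon>" if "p \<in> X" "0 < \<epsilon>" for p \<epsilon>
  proof -
    have "p \<in> mtopology closure_of C" using that C(3) by simp
    then have "\<exists>y\<in>C. y \<in> mball p \<epsilon>"
      using that(2) unfolding metric_closure_of by blast
    then obtain y where "y \<in> C" "m p y < \<epsilon>" by auto
    then show ?thesis using xC by auto
  qed
  define e where "e p i = m p (x i)" for p i
  have ball_measurable: "mball p r \<in> sets M" for p r
    unfolding \<tau>(4) using \<tau>_eq by (intro sigma_sets.Basic) simp
  have e_measurable: "e \<in> borel_measurable M"
  proof (rule measurable_coordinatewise_then_product)
    fix i
    have "{p \<in> space M. e p i < r} = mball (x i) r" for r
      by (auto simp: X e_def commute)
    then show "(\<lambda>p. e p i) \<in> borel_measurable M"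
      using ball_measurable by (simp add: borel_measurable_iff_less)
  qed
  have e_inj: "inj_on e (space M)"
  proof (rule inj_onI, rule ccontr)
    fix p q assume pq: "p \<in> space M" "q \<in> space M" "e p = e q" "p \<noteq> q"
    then have "0 < m p q / 2" using X by simp
    then obtain i where i: "m p (x i) < m p q / 2" using dense pq X by blast
    moreover have "m q (x i) = m p (x i)" using fun_cong[OF pq(3), of i] by (simp add: e_def)
    moreover have "m p q \<le> m p (x i) + m q (x i)"
      using triangle[of p "x i" q] pq X by (simp add: commute)
    ultimately show False by linarith
  qed
  have open_half: "open {v :: nat \<Rightarrow> real. v i < r}" for i r
    by (intro open_Collect_less continuous_intros) (rule continuous_on_product_coordinates)
  have e_sets: "\<exists>B\<in>sets borel. S = e -` B \<inter> space M" if "S \<in> sets M" for S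
    using that unfolding \<tau>(4)
  proof (induction rule: sigma_sets.induct)
    case (Basic U)
    then have U: "openin mtopology U" using \<tau>_eq by simp
    \<comment> \<open>Balls around the \<open>x i\<close> form a base, and each is the preimage of
      an open half-space; \<open>B\<close> is the union of those half-spaces whose balls lie in
      \<open>U\<close>.\<close>
    define J where "J = {(i, k). mball (x i) (1 / real (Suc k)) \<subseteq> U}"
    define B where "B = (\<Union>(i, k)\<in>J. {v :: nat \<Rightarrow> real. v i < 1 / real (Suc k)})"
    have "open B" unfolding B_def using open_half by (intro open_UN) auto
    moreover have "U = e -` B \<inter> space M"
    proof (intro equalityI subsetI)
      fix p assume p: "p \<in> U"
      then obtain r where r: "0 < r" "mball p r \<subseteq> U" and pX: "p \<in> X"
        using U unfolding openin_mtopology by blast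
      obtain k where k: "1 / real (Suc k) < r / 2"
        using nat_approx_posE[of "r / 2"] r(1) by auto
      obtain i where i: "m p (x i) < 1 / real (Suc k)"
        using dense[OF pX, of "1 / real (Suc k)"] by auto
      have "mball (x i) (1 / real (Suc k)) \<subseteq> mball p r"
      proof
        fix q assume q: "q \<in> mball (x i) (1 / real (Suc k))"
        then have "m p q \<le> m p (x i) + m (x i) q" using triangle pX by simp
        also have "\<dots> < r" using i k q by (auto simp del: of_nat_Suc)
        finally show "q \<in> mball p r" using q pX by simp
      qed
      then have "(i, k) \<in> J" using r(2) by (auto simp: J_def)
      then have "e p \<in> B"
        unfolding B_def using i by (intro UN_I[of "(i, k)"]) (simp_all add: e_def)
      then show "p \<in> e -` B \<inter> space M"
        using pX by (simp add: X)
    next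
      fix p assume "p \<in> e -` B \<inter> space M"
      then obtain i k where "(i, k) \<in> J" "m p (x i) < 1 / real (Suc k)" "p \<in> X"
        by (auto simp: X B_def e_def simp del: of_nat_Suc)
      then have "p \<in> mball (x i) (1 / real (Suc k))" by (simp add: commute del: of_nat_Suc)
      with \<open>(i, k) \<in> J\<close> show "p \<in> U" unfolding J_def by blast
    qed
    ultimately show ?case by (intro bexI[of _ B]) auto
  next
    case Empty
    then show ?case by (intro bexI[of _ "{}"]) auto
  next
    case (Compl S)
    then obtain B where "B \<in> sets borel" "S = e -` B \<inter> space M" by blast
    then show ?case by (intro bexI[of _ "- B"]) auto
  next
    case (Union S)
    then obtain B where "\<And>i. B i \<in> sets borel" "\<And>i. S i = e -` B i \<inter> space M" by metis
    then show ?case by (intro bexI[of _ "\<Union>i. B i"]) auto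
  qed
  \<comment> \<open>If the coordinates of a limit of image points come arbitrarily close to 0, then these points
    form a Cauchy sequence.\<close>
  have "e ` X = closure (e ` X) \<inter> (\<Inter>k. \<Union>i. {v. v i < 1 / real (Suc k)})"
  proof (intro equalityI subsetI IntI)
    fix v assume v: "v \<in> e ` X"
    then show "v \<in> closure (e ` X)" using closure_subset by (rule subsetD[rotated])
    show "v \<in> (\<Inter>k. \<Union>i. {v. v i < 1 / real (Suc k)})"
      using v dense by (auto simp: e_def)
  next
    fix v assume v: "v \<in> closure (e ` X) \<inter> (\<Inter>k. \<Union>i. {v. v i < 1 / real (Suc k)})"
    then have "\<exists>i. v i < 1 / real (Suc k)" for k by blast
    then have "\<exists>i. \<forall>k. v (i k) < 1 / real (Suc k)" by (intro choice allI)
    then obtain i where i: "\<forall>k. v (i k) < 1 / real (Suc k)" by (rule exE)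
    have "v \<in> closure (e ` X)" using v by (rule IntD1)
    then obtain y where y: "\<forall>n. y n \<in> e ` X" "y \<longlonglongrightarrow> v"
      by (auto simp only: closure_sequential)
    from y(1) have "\<exists>p. p \<in> X \<and> y n = e p" for n by (auto simp: image_iff)
    then have "\<exists>p. \<forall>n. p n \<in> X \<and> y n = e (p n)" by (intro choice allI)
    then obtain p where p: "\<And>n. p n \<in> X" "\<And>n. y n = e (p n)" by blast
    have coord: "(\<lambda>n. m (p n) (x j)) \<longlonglongrightarrow> v j" for j
      using continuous_on_tendsto_compose[OF continuous_on_product_coordinates[of j] y(2)] p(2)
      by (simp add: e_def)
    have "MCauchy p"
      unfolding MCauchy_def
    proof (intro conjI allI impI)
      show "range p \<subseteq> X" using p(1) by auto
      fix \<epsilon> :: real assume "0 < \<epsilon>"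
      then obtain k where k: "1 / real (Suc k) < \<epsilon> / 2"
        using nat_approx_posE[of "\<epsilon> / 2"] by auto
      have "v (i k) < \<epsilon> / 2" using spec[OF i, of k] k by linarith
      then have "\<forall>\<^sub>F n in sequentially. m (p n) (x (i k)) < \<epsilon> / 2"
        using coord[of "i k"] by (rule order_tendstoD(2)[rotated])
      then obtain N where N: "\<And>n. n \<ge> N \<Longrightarrow> m (p n) (x (i k)) < \<epsilon> / 2"
        unfolding eventually_sequentially by blast
      have "m (p n) (p n') < \<epsilon>" if "N \<le> n" "N \<le> n'" for n n'
        using triangle[of "p n" "x (i k)" "p n'"] N[OF that(1)] N[OF that(2)] p(1)
        by (simp add: commute)
      then show "\<exists>N. \<forall>n n'. N \<le> n \<longrightarrow> N \<le> n' \<longrightarrow> m (p n) (p n') < \<epsilon>" by blast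
    qed
    then obtain q where q: "limitin mtopology p q sequentially"
      using complete unfolding mcomplete_def by blast
    then have qX: "q \<in> X" and q_lim: "(\<lambda>n. m (p n) q) \<longlonglongrightarrow> 0"
      by (simp_all add: limitin_metric_dist_null)
    have "v j = m q (x j)" for j
    proof (rule LIMSEQ_unique[OF coord])
      have "(\<lambda>n. m (p n) (x j) - m q (x j)) \<longlonglongrightarrow> 0"
      proof (rule Lim_null_comparison[OF _ q_lim])
        have "\<bar>m (p n) (x j) - m q (x j)\<bar> \<le> m (p n) q" for n
          using triangle[of "p n" q "x j"] triangle[of q "p n" "x j"] p(1) qX
          by (simp add: commute[of q])
        then show "\<forall>\<^sub>F n in sequentially. norm (m (p n) (x j) - m q (x j)) \<le> m (p n) q" by simp
      qed
      then show "(\<lambda>n. m (p n) (x j)) \<longlonglongrightarrow> m q (x j)"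
        using LIM_zero_iff by blast
    qed
    then have "v = e q" by (auto simp: e_def)
    then show "v \<in> e ` X" using qX by blast
  qed
  also have "\<dots> \<in> sets borel"
    using open_half by (intro sets.Int sets.countable_INT' sets.countable_UN'') auto
  finally have "e ` space M \<in> sets borel" using X by simp
  then show thesis using that e_measurable e_inj e_sets by blast
qed


text \<open>A null set is given away for compactness. The map \<open>(e, f)\<close> into a Polish
  space has a Borel image of \<open>A\<close>; inner regularity fills this image, up to a null set,
  with countably many compact sets, and on each of them the projection to the second factor is a
  homeomorphism onto a compact set.\<close>

lemma inj_measurable_imp_bimeasurable_mod_0:
  fixes f :: "'a \<Rightarrow> 'b::{second_countable_topology, complete_space}"
  assumes "standard_Borel M" "finite_measure M" and f: "f \<in> borel_measurable M"
    and A: "A \<in> sets M" and inj: "inj_on f A"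
  obtains B where "B \<in> sets M" "B \<subseteq> A" "emeasure M (A - B) = 0" "f ` B \<in> sets borel"
    "inv_into B f \<in> restrict_space borel (f ` B) \<rightarrow>\<^sub>M M"
proof -
  interpret finite_measure M by fact
  obtain e :: "'a \<Rightarrow> nat \<Rightarrow> real" where e: "e \<in> borel_measurable M"
    and e_inj: "inj_on e (space M)" and e_img: "e ` space M \<in> sets borel"
    and e_sets: "\<And>S. S \<in> sets M \<Longrightarrow> \<exists>B\<in>sets borel. S = e -` B \<inter> space M"
    using standard_Borel_embedding[OF assms(1)] by blast
  have A_sub: "A \<subseteq> space M" by (rule sets.sets_into_space[OF A])
  have measurable_into_M: "h \<in> L \<rightarrow>\<^sub>M M"
    if h: "h \<in> space L \<rightarrow> space M" "(\<lambda>y. e (h y)) \<in> borel_measurable L" for h and L :: "'c measure"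
  proof (rule measurableI)
    fix S assume "S \<in> sets M"
    then obtain B where "B \<in> sets borel" "S = e -` B \<inter> space M" using e_sets by blast
    moreover from this have "h -` S \<inter> space L = (\<lambda>y. e (h y)) -` B \<inter> space L" using h(1) by auto
    ultimately show "h -` S \<inter> space L \<in> sets L"
      using measurable_sets[OF h(2)] by simp
  qed (use h(1) in auto)
  define g where "g x = (e x, f x)" for x
  have g: "g \<in> borel_measurable M"
    unfolding g_def by (intro borel_measurable_Pair e f)
  have g_inj: "inj_on g (space M)"
    using e_inj by (auto simp: inj_on_def g_def)
  obtain A' where A': "A' \<in> sets borel" "A = e -` A' \<inter> space M"
    using e_sets[OF A] by blast
  have graph: "g ` A \<in> sets borel"
  proof -
    \<comment> \<open>The first component of a pair in \<open>\<Omega>\<close> encodes a point of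
      \<open>A\<close>. Over \<open>\<Omega>\<close> the image under \<open>g\<close> is the graph
      of a Borel function, hence a set where two Borel functions agree.\<close>
    define \<Omega> where "\<Omega> = (fst :: (nat \<Rightarrow> real) \<times> 'b \<Rightarrow> _) -` (e ` space M \<inter> A')"
    have \<Omega>: "\<Omega> \<in> sets borel"
      unfolding \<Omega>_def using e_img A'(1)
      by (intro measurable_sets_borel[where M = borel] borel_measurable_continuous_onI continuous_intros sets.Int)
    have "(\<lambda>p. inv_into (space M) e (fst p)) \<in> restrict_space borel \<Omega> \<rightarrow>\<^sub>M M"
    proof (rule measurable_into_M)
      show "(\<lambda>p. inv_into (space M) e (fst p)) \<in> space (restrict_space borel \<Omega>) \<rightarrow> space M"
        by (auto simp: space_restrict_space \<Omega>_def intro: inv_into_into)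
      have "fst \<in> borel_measurable (restrict_space borel \<Omega>)"
        by (intro borel_measurable_continuous_on_restrict continuous_intros)
      moreover have "e (inv_into (space M) e (fst p)) = fst p" if "p \<in> space (restrict_space borel \<Omega>)" for p
        using that by (auto simp: space_restrict_space \<Omega>_def f_inv_into_f)
      ultimately show "(\<lambda>p. e (inv_into (space M) e (fst p))) \<in> borel_measurable (restrict_space borel \<Omega>)"
        by (simp cong: measurable_cong)
    qed
    then have "(\<lambda>p. f (inv_into (space M) e (fst p))) \<in> borel_measurable (restrict_space borel \<Omega>)"
      by (rule measurable_compose[OF _ f])
    moreover have "snd \<in> borel_measurable (restrict_space borel \<Omega>)"
      by (intro borel_measurable_continuous_on_restrict continuous_intros)
    ultimately have "{p \<in> space (restrict_space borel \<Omega>). f (inv_into (space M) e (fst p)) = snd p}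
        \<in> sets (restrict_space borel \<Omega>)"
      by (rule measurable_equality_set)
    moreover have "{p \<in> space (restrict_space borel \<Omega>). f (inv_into (space M) e (fst p)) = snd p} = g ` A"
      using A_sub A'(2) e_inj by (auto simp: space_restrict_space \<Omega>_def g_def image_iff Bex_def inv_into_f_f)
    ultimately show ?thesis
      using \<Omega> by (simp add: sets_restrict_space_iff)
  qed
  define \<nu> where "\<nu> = distr M borel g"
  have \<nu>: "emeasure \<nu> C = emeasure M (g -` C \<inter> space M)" if "C \<in> sets borel" for C
    unfolding \<nu>_def using emeasure_distr[OF g that] .
  have "emeasure \<nu> (g ` A) = (SUP K \<in> {K. K \<subseteq> g ` A \<and> compact K}. emeasure \<nu> K)"
    using \<nu>[of UNIV] by (intro inner_regular graph) (auto simp: \<nu>_def)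
  \<comment> \<open>The supremum is reached along a sequence, so countably many compact sets
    suffice.\<close>
  moreover have "\<exists>S :: nat \<Rightarrow> ennreal. range S \<subseteq> emeasure \<nu> ` {K. K \<subseteq> g ` A \<and> compact K} \<and>
      (SUP K \<in> {K. K \<subseteq> g ` A \<and> compact K}. emeasure \<nu> K) = (SUP i. S i)"
    by (rule ennreal_SUP_countable_SUP) auto
  ultimately obtain S :: "nat \<Rightarrow> ennreal" where S: "range S \<subseteq> emeasure \<nu> ` {K. K \<subseteq> g ` A \<and> compact K}"
    "emeasure \<nu> (g ` A) = (SUP i. S i)"
    by auto
  then have "\<exists>K. \<forall>i. K i \<subseteq> g ` A \<and> compact (K i) \<and> S i = emeasure \<nu> (K i)"
    by (intro choice allI) blast
  then obtain K where K: "\<And>i. K i \<subseteq> g ` A" "\<And>i. compact (K i)" "\<And>i. S i = emeasure \<nu> (K i)"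
    by blast
  define C where "C = (\<Union>i. K i)"
  have "range K \<subseteq> sets borel"
    using K(2) by (auto intro: borel_compact)
  then have C: "C \<in> sets borel" "C \<subseteq> g ` A"
    unfolding C_def using K(1) by (auto intro: sets.countable_UN)
  have "emeasure \<nu> (g ` A) \<le> emeasure \<nu> C"
    unfolding S(2) K(3) using C(1) by (intro SUP_least emeasure_mono) (auto simp: C_def \<nu>_def)
  then have "emeasure \<nu> (g ` A - C) = 0"
    using emeasure_Diff[of \<nu> C "g ` A"] C graph \<nu>[OF C(1)] \<nu>[OF graph]
    by (simp add: \<nu>_def diff_eq_0_iff_ennreal less_top[symmetric])
  define B where "B = g -` C \<inter> space M"
  have B: "B \<in> sets M"
    unfolding B_def using measurable_sets[OF g C(1)] .
  have gA: "g x \<in> g ` A \<longleftrightarrow> x \<in> A" if "x \<in> space M" for x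
    by (rule inj_on_image_mem_iff[OF g_inj that A_sub])
  have BA: "B \<subseteq> A"
    unfolding B_def using C(2) gA by blast
  have "g -` (g ` A - C) \<inter> space M = A - B"
    using gA A_sub unfolding B_def by blast
  then have null: "emeasure M (A - B) = 0"
    using \<open>emeasure \<nu> (g ` A - C) = 0\<close> \<nu>[of "g ` A - C"] C graph by simp
  have gB: "g ` B = C"
    using C(2) A_sub unfolding B_def by blast
  have "f ` B = snd ` g ` B"
    by (simp add: image_image g_def)
  then have fB: "f ` B = (\<Union>i. snd ` K i)"
    by (simp add: gB C_def image_UN)
  have snd_K: "compact (snd ` K i)" for i
    using K(2) by (intro compact_continuous_image continuous_intros)
  have "range (\<lambda>i. snd ` K i) \<subseteq> sets borel"
    using snd_K by (auto intro: borel_compact)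
  then have f_img: "f ` B \<in> sets borel"
    unfolding fB by (rule sets.countable_UN)
  have inv: "inv_into B f (f x) = x" if "x \<in> B" for x
    using inj_on_subset[OF inj BA] that by simp
  have "inv_into B f \<in> restrict_space borel (f ` B) \<rightarrow>\<^sub>M M"
  proof (rule measurable_into_M)
    show "inv_into B f \<in> space (restrict_space borel (f ` B)) \<rightarrow> space M"
      using BA A_sub inv by (auto simp: space_restrict_space)
    show "(\<lambda>y. e (inv_into B f y)) \<in> borel_measurable (restrict_space borel (f ` B))"
    proof (rule measurable_piecewise_restrict[where C = "range (\<lambda>i. snd ` K i)"])
      fix \<Omega> assume "\<Omega> \<in> range (\<lambda>i. snd ` K i)"
      then obtain i where i: "\<Omega> = snd ` K i" by blast
      \<comment> \<open>The projection \<open>snd\<close> is a continuous injection on a compact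
        set, so its inverse is continuous. This is the gain from passing from \<open>f\<close>,
        merely Borel, to its graph.\<close>
      have "continuous_on (snd ` K i) (\<lambda>y. (e (inv_into B f y), y))"
      proof (rule continuous_on_inv[OF _ K(2)])
        show "\<forall>p\<in>K i. (e (inv_into B f (snd p)), snd p) = p"
        proof
          fix p assume "p \<in> K i"
          then have "p \<in> g ` B" unfolding gB C_def by blast
          then obtain x where "x \<in> B" "p = g x" by blast
          then show "(e (inv_into B f (snd p)), snd p) = p" by (simp add: g_def inv)
        qed
      qed (intro continuous_intros)
      from continuous_on_fst[OF this] have "continuous_on \<Omega> (\<lambda>y. e (inv_into B f y))"
        by (simp add: i)
      moreover have "f ` B \<inter> \<Omega> = \<Omega>" using fB i by blast
      ultimately show "(\<lambda>y. e (inv_into B f y)) \<in> borel_measurable (restrict_space (restrict_space borel (f ` B)) \<Omega>)"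
        using f_img snd_K[of i]
        by (simp add: restrict_restrict_space i borel_compact borel_measurable_continuous_on_restrict)
      show "\<Omega> \<inter> space (restrict_space borel (f ` B)) \<in> sets (restrict_space borel (f ` B))"
        using f_img snd_K[of i] i by (auto simp: sets_restrict_space_iff space_restrict_space borel_compact)
    qed (auto simp: fB space_restrict_space)
  qed
  then show thesis using that B BA null f_img by blast
qed

section \<open>The metric of an insensitive system\<close>

context mp_system
begin

lemma funpow_measurable: "T ^^ n \<in> M \<rightarrow>\<^sub>M M"
proof (induction n)
  case (Suc n)
  then show ?case using measurable_comp[OF Suc measurable_map] by (simp only: funpow.simps(2))
qed (simp add: id_def)

lemma funpow_in_space [simp]: "x \<in> space M \<Longrightarrow> (T ^^ n) x \<in> space M"
  using measurable_space[OF funpow_measurable] .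

lemma T_in_space [simp]: "x \<in> space M \<Longrightarrow> T x \<in> space M"
  using measurable_space[OF measurable_map] .

lemma funpow_preserves_measure:
  assumes "A \<in> sets M"
  shows "emeasure M ((T ^^ n) -` A \<inter> space M) = emeasure M A"
proof (induction n)
  case 0
  then show ?case using sets.sets_into_space[OF assms] by (simp add: Int_absorb2)
next
  case (Suc n)
  have "(T ^^ Suc n) -` A \<inter> space M = T -` ((T ^^ n) -` A \<inter> space M) \<inter> space M"
    by (auto simp: funpow_swap1)
  then show ?case
    using preserves_measure[OF measurable_sets[OF funpow_measurable assms, of n]] Suc by (simp only:)
qed

lemma AE_null_complement:
  assumes "A \<in> sets M" "AE x in M. x \<in> A"
  shows "emeasure M (space M - A) = 0"
proof -
  have "{x \<in> space M. x \<notin> A} = space M - A" by blast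
  then show ?thesis
    using AE_iff_null[of M "\<lambda>x. x \<in> A"] assms by auto
qed

lemma null_complement_AE:
  assumes "A \<in> sets M" "emeasure M (space M - A) = 0"
  shows "AE x in M. x \<in> A"
  by (rule AE_I[of _ _ "space M - A"]) (use assms in auto)

text \<open>Ergodicity speaks of strictly invariant sets. The preimages of \<open>A\<close> under
  the iterates increase, all have the measure of \<open>A\<close>, and their union is strictly
  invariant.\<close>

lemma ergodic_subinvariant:
  assumes "ergodic M T" and A: "A \<in> sets M" and sub: "\<And>x. x \<in> A \<Longrightarrow> T x \<in> A"
  shows "emeasure M A = 0 \<or> emeasure M (space M - A) = 0"
proof -
  define B where "B n = (T ^^ n) -` A \<inter> space M" for n
  have B: "B n \<in> sets M" for n
    unfolding B_def by (rule measurable_sets[OF funpow_measurable A])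
  have A_space: "A \<subseteq> space M" by (rule sets.sets_into_space[OF A])
  have B_Suc: "T -` B n \<inter> space M = B (Suc n)" for n
    by (auto simp: B_def funpow_swap1)
  have "B n \<subseteq> B (Suc n)" for n
    using sub by (auto simp: B_def)
  then have "incseq B" by (rule incseq_SucI)
  have "T -` (\<Union>n. B n) \<inter> space M = (\<Union>n. B (Suc n))"
    using B_Suc by blast
  also have "\<dots> = (\<Union>n. B n)"
    using \<open>\<And>n. B n \<subseteq> B (Suc n)\<close> by blast
  finally have "emeasure M (\<Union>n. B n) = 0 \<or> emeasure M (space M - (\<Union>n. B n)) = 0"
    using assms(1) B unfolding ergodic_def by (metis sets.countable_UN image_subsetI)
  moreover have eq: "emeasure M (\<Union>n. B n) = emeasure M A"
  proof -
    have "(SUP n. emeasure M (B n)) = emeasure M (\<Union>n. B n)"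
      using \<open>incseq B\<close> B by (intro SUP_emeasure_incseq) auto
    then show ?thesis
      using funpow_preserves_measure[OF A] by (simp add: B_def)
  qed
  moreover have "(\<Union>n. B n) \<in> sets M"
    using B by auto
  ultimately show ?thesis
    using A emeasure_compl[of A M] emeasure_compl[of "\<Union>n. B n" M] by simp
qed

end

section \<open>The non-expanding metric \<open>D\<close>\<close>

locale non_sensitive_system = mp_system M T for M :: "'a measure" and T +
  fixes d :: "'a \<Rightarrow> 'a \<Rightarrow> real"
  assumes ergodic: "ergodic M T"
    and metric: "bounded_Borel_metric M d"
    and not_sensitive: "\<not> pairwise_sensitive M T d"
begin

sublocale d: Metric_space "space M" d
  using metric by (simp add: bounded_Borel_metric_def)

definition D :: "'a \<Rightarrow> 'a \<Rightarrow> real" where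
  "D x y = (SUP n. d ((T ^^ n) x) ((T ^^ n) y))"

lemma d_le_1: "x \<in> space M \<Longrightarrow> y \<in> space M \<Longrightarrow> d x y \<le> 1"
  using metric by (simp add: bounded_Borel_metric_def)

lemma bdd: "x \<in> space M \<Longrightarrow> y \<in> space M \<Longrightarrow> bdd_above (range (\<lambda>n. d ((T ^^ n) x) ((T ^^ n) y)))"
  by (rule bdd_aboveI[of _ 1]) (auto simp: d_le_1)

lemma d_le_D: "x \<in> space M \<Longrightarrow> y \<in> space M \<Longrightarrow> d ((T ^^ n) x) ((T ^^ n) y) \<le> D x y"
  unfolding D_def by (intro cSUP_upper bdd) auto

lemma D_least: "(\<And>n. d ((T ^^ n) x) ((T ^^ n) y) \<le> r) \<Longrightarrow> D x y \<le> r"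
  unfolding D_def by (intro cSUP_least) auto

lemma D_le_1: "x \<in> space M \<Longrightarrow> y \<in> space M \<Longrightarrow> D x y \<le> 1"
  by (intro D_least) (simp add: d_le_1)

lemma D_commute: "D x y = D y x"
  by (simp add: D_def d.commute)

lemma D_self [simp]: "x \<in> space M \<Longrightarrow> D x x = 0"
  by (simp add: D_def)

lemma D_nonneg: "x \<in> space M \<Longrightarrow> y \<in> space M \<Longrightarrow> 0 \<le> D x y"
  by (rule order_trans[OF d.nonneg d_le_D[of _ _ 0]])

lemma D_eq_0: "x \<in> space M \<Longrightarrow> y \<in> space M \<Longrightarrow> D x y = 0 \<Longrightarrow> x = y"
  using d_le_D[of x y 0] d.nonneg[of x y] by simp

lemma D_triangle:
  assumes "x \<in> space M" "y \<in> space M" "z \<in> space M"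
  shows "D x z \<le> D x y + D y z"
proof (rule D_least)
  fix n
  have "d ((T ^^ n) x) ((T ^^ n) z) \<le> d ((T ^^ n) x) ((T ^^ n) y) + d ((T ^^ n) y) ((T ^^ n) z)"
    using assms by (intro d.triangle) auto
  then show "d ((T ^^ n) x) ((T ^^ n) z) \<le> D x y + D y z"
    using d_le_D[of x y n] d_le_D[of y z n] assms by linarith
qed

lemma D_T_le:
  assumes "x \<in> space M" "y \<in> space M"
  shows "D (T x) (T y) \<le> D x y"
proof (rule D_least)
  show "d ((T ^^ n) (T x)) ((T ^^ n) (T y)) \<le> D x y" for n
    using d_le_D[OF assms, of "Suc n"] by (simp add: funpow_swap1)
qed

text \<open>The supremum runs over countably many times, and \<open>d\<close> is bounded; this is
  the only link between \<open>D\<close> and the Borel structure.\<close>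

lemma D_measurable: "(\<lambda>p. D (fst p) (snd p)) \<in> borel_measurable (M \<Otimes>\<^sub>M M)"
  unfolding D_def
proof (rule borel_measurable_cSUP)
  have d: "(\<lambda>p. d (fst p) (snd p)) \<in> borel_measurable (M \<Otimes>\<^sub>M M)"
    using metric by (simp add: bounded_Borel_metric_def case_prod_unfold)
  fix n
  have "(\<lambda>p. ((T ^^ n) (fst p), (T ^^ n) (snd p))) \<in> M \<Otimes>\<^sub>M M \<rightarrow>\<^sub>M M \<Otimes>\<^sub>M M"
    by (intro measurable_Pair measurable_compose[OF measurable_fst funpow_measurable]
        measurable_compose[OF measurable_snd funpow_measurable])
  from measurable_compose[OF this d]
  show "(\<lambda>p. d ((T ^^ n) (fst p)) ((T ^^ n) (snd p))) \<in> borel_measurable (M \<Otimes>\<^sub>M M)"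
    by simp
next
  fix p assume "p \<in> space (M \<Otimes>\<^sub>M M)"
  then show "bdd_above (range (\<lambda>n. d ((T ^^ n) (fst p)) ((T ^^ n) (snd p))))"
    by (intro bdd) (auto simp: space_pair_measure)
qed simp

section \<open>Measures of \<open>D\<close>-balls\<close>

definition D_ball :: "'a \<Rightarrow> real \<Rightarrow> 'a set" where
  "D_ball x r = {y \<in> space M. D x y < r}"

lemma D_fiber_measurable: "y \<in> space M \<Longrightarrow> (\<lambda>x. D x y) \<in> borel_measurable M"
  using measurable_compose[OF measurable_Pair2' D_measurable, of y] by simp

lemma D_ball_sets: "x \<in> space M \<Longrightarrow> D_ball x r \<in> sets M"
  using borel_measurable_less[OF D_fiber_measurable[of x] borel_measurable_const[of r]]
  by (simp add: D_ball_def D_commute[of x])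

lemma near_diagonal_sets: "{p \<in> space (M \<Otimes>\<^sub>M M). D (fst p) (snd p) < r} \<in> sets (M \<Otimes>\<^sub>M M)"
  using borel_measurable_less[OF D_measurable borel_measurable_const[of r]] .

lemma near_diagonal_section:
  "x \<in> space M \<Longrightarrow> Pair x -` {p \<in> space (M \<Otimes>\<^sub>M M). D (fst p) (snd p) < r} = D_ball x r"
  by (auto simp: D_ball_def space_pair_measure)

lemma measure_D_ball_measurable: "(\<lambda>x. measure M (D_ball x r)) \<in> borel_measurable M"
proof -
  have "(\<lambda>x. enn2real (emeasure M (Pair x -` {p \<in> space (M \<Otimes>\<^sub>M M). D (fst p) (snd p) < r})))
      \<in> borel_measurable M"
    using measurable_emeasure_Pair[OF near_diagonal_sets[of r]] by (rule borel_measurable_enn2real)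
  then show ?thesis
    using near_diagonal_section by (simp add: measure_def cong: measurable_cong)
qed

text \<open>As \<open>D\<close> does not expand, the ball around \<open>x\<close> lies in the
  preimage of the ball around \<open>T x\<close>, and preimages keep their measure.\<close>

lemma measure_D_ball_T:
  assumes "x \<in> space M"
  shows "measure M (D_ball x r) \<le> measure M (D_ball (T x) r)"
proof -
  have "D_ball x r \<subseteq> T -` D_ball (T x) r \<inter> space M"
    using assms D_T_le[of x] by (fastforce simp: D_ball_def)
  then have "measure M (D_ball x r) \<le> measure M (T -` D_ball (T x) r \<inter> space M)"
    using assms by (intro finite_measure_mono measurable_sets[OF measurable_map] D_ball_sets) simp_all
  then show ?thesis
    using preserves_measure[OF D_ball_sets[of "T x" r]] assms by (simp add: measure_def)
qed

lemma D_ball_lower_bound: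
  assumes "0 < r"
  shows "\<exists>c>0. AE x in M. c < measure M (D_ball x r)"
proof -
  define f where "f x = measure M (D_ball x r)" for x
  \<comment> \<open>One of these countably many superlevel sets has positive measure unless almost
    every ball is null, and \<open>T\<close> maps each of them into itself.\<close>
  define P where "P k = {x \<in> space M. 1 / real (Suc k) < f x}" for k
  have f: "f \<in> borel_measurable M"
    unfolding f_def by (rule measure_D_ball_measurable)
  have P: "P k \<in> sets M" for k
    unfolding P_def using borel_measurable_less[OF borel_measurable_const f] by simp
  have "\<exists>k. emeasure M (P k) \<noteq> 0"
  proof (rule ccontr)
    assume "\<nexists>k. emeasure M (P k) \<noteq> 0"
    then have "AE x in M. x \<notin> P k" for k
      using P by (intro AE_not_in null_setsI) auto
    then have "AE x in M. \<forall>k. x \<notin> P k"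
      by (simp add: AE_all_countable)
    moreover have "f x = 0" if x: "x \<in> space M" "\<forall>k. x \<notin> P k" for x
    proof (rule ccontr)
      assume "f x \<noteq> 0"
      then have "0 < f x" by (simp add: f_def zero_less_measure_iff)
      then obtain k where "1 / real (Suc k) < f x"
        using nat_approx_posE by blast
      then show False using x by (simp add: P_def)
    qed
    ultimately have AE0: "AE x in M. f x = 0"
      by (elim AE_mp) (auto intro: AE_I2)
    \<comment> \<open>By Fubini, null balls at almost every centre make this whole neighbourhood of
      the diagonal null.\<close>
    let ?Q = "{p \<in> space (M \<Otimes>\<^sub>M M). D (fst p) (snd p) < r}"
    have "emeasure (M \<Otimes>\<^sub>M M) ?Q = (\<integral>\<^sup>+x. emeasure M (Pair x -` ?Q) \<partial>M)"
      by (rule emeasure_pair_measure_alt[OF near_diagonal_sets])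
    also have "\<dots> = (\<integral>\<^sup>+x. ennreal (f x) \<partial>M)"
      by (intro nn_integral_cong) (simp only: near_diagonal_section f_def emeasure_eq_measure)
    also have "\<dots> = (\<integral>\<^sup>+x. 0 \<partial>M)"
      using AE0 by (intro nn_integral_cong_AE) auto
    finally have "emeasure (M \<Otimes>\<^sub>M M) ?Q = 0" by simp
    then have "AE p in M \<Otimes>\<^sub>M M. p \<notin> ?Q"
      using near_diagonal_sets by (intro AE_not_in null_setsI)
    \<comment> \<open>The supremum \<open>D x y \<ge> r\<close> need not be attained, so the
      sensitivity constant is taken as \<open>r / 2\<close>.\<close>
    then have "AE (x, y) in M \<Otimes>\<^sub>M M. \<exists>n. r / 2 \<le> d ((T ^^ n) x) ((T ^^ n) y)"
    proof (rule AE_mp, intro AE_I2 impI)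
      fix p assume p: "p \<in> space (M \<Otimes>\<^sub>M M)" "p \<notin> ?Q"
      have "\<exists>n. r / 2 \<le> d ((T ^^ n) (fst p)) ((T ^^ n) (snd p))"
      proof (rule ccontr)
        assume "\<nexists>n. r / 2 \<le> d ((T ^^ n) (fst p)) ((T ^^ n) (snd p))"
        then have "D (fst p) (snd p) \<le> r / 2"
          by (intro D_least) (meson not_le less_imp_le)
        then show False using p assms by simp
      qed
      then show "case p of (x, y) \<Rightarrow> \<exists>n. r / 2 \<le> d ((T ^^ n) x) ((T ^^ n) y)"
        by (simp add: case_prod_unfold)
    qed
    then show False
      using not_sensitive assms unfolding pairwise_sensitive_def by (meson half_gt_zero)
  qed
  then obtain k where k: "emeasure M (P k) \<noteq> 0" by blast
  have "T x \<in> P k" if "x \<in> P k" for x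
    using that measure_D_ball_T[of x r] by (auto simp: P_def f_def intro: less_le_trans)
  then have "emeasure M (space M - P k) = 0"
    using ergodic_subinvariant[OF ergodic P] k by blast
  then have "AE x in M. x \<notin> space M - P k"
    using P by (intro AE_not_in null_setsI) auto
  then have "AE x in M. 1 / real (Suc k) < measure M (D_ball x r)"
    by (rule AE_mp) (auto simp: P_def f_def)
  then show ?thesis
    by (intro exI[of _ "1 / real (Suc k)"] conjI) simp_all
qed

text \<open>Restricting to the radii \<open>1 / real (Suc k)\<close> keeps the exceptional set null.
  \<open>X\<close> is closed under \<open>T\<close> because ball measures do not decrease along
  orbits.\<close>

lemma uniform_domain:
  obtains X c where "X \<in> sets M" "emeasure M (space M - X) = 0" "\<And>x. x \<in> X \<Longrightarrow> T x \<in> X"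
    "\<And>k. 0 < c k" "\<And>x k. x \<in> X \<Longrightarrow> c k < measure M (D_ball x (1 / real (Suc k)))"
proof -
  have "\<exists>c. \<forall>k. 0 < c k \<and> (AE x in M. c k < measure M (D_ball x (1 / real (Suc k))))"
    using D_ball_lower_bound by (intro choice allI) simp
  then obtain c where c: "\<And>k. 0 < c k" "\<And>k. AE x in M. c k < measure M (D_ball x (1 / real (Suc k)))"
    by blast
  define X where "X = {x \<in> space M. \<forall>k. c k < measure M (D_ball x (1 / real (Suc k)))}"
  have X: "X \<in> sets M"
    unfolding X_def
    by (intro sets.sets_Collect_countable_All borel_measurable_less borel_measurable_const measure_D_ball_measurable)
  have "AE x in M. \<forall>k. c k < measure M (D_ball x (1 / real (Suc k)))"
    using c(2) by (simp add: AE_all_countable)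
  then have "AE x in M. x \<in> X"
    by (rule AE_mp) (auto simp: X_def)
  then have "emeasure M (space M - X) = 0"
    by (rule AE_null_complement[OF X])
  moreover have "T x \<in> X" if "x \<in> X" for x
    using that measure_D_ball_T by (force simp: X_def intro: less_le_trans)
  moreover have "c k < measure M (D_ball x (1 / real (Suc k)))" if "x \<in> X" for x k
    using that by (simp add: X_def)
  ultimately show thesis
    using that X c(1) by blast
qed

section \<open>Total boundedness and dense orbits\<close>

lemma finite_D_net:
  assumes X: "X \<subseteq> space M" and "0 < c" and c: "\<And>x. x \<in> X \<Longrightarrow> c < measure M (D_ball x s)"
    and "2 * s \<le> r"
  shows "\<exists>F. finite F \<and> F \<subseteq> X \<and> (\<forall>x\<in>X. \<exists>y\<in>F. D y x < r)"
proof -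
  \<comment> \<open>A packing argument: the \<open>s\<close>-balls around \<open>r\<close>-separated
    points are disjoint and each has mass above \<open>c\<close>, which bounds the number of points.
    A separated set of maximal size is then a net.\<close>
  define sep where "sep F \<longleftrightarrow> finite F \<and> F \<subseteq> X \<and> (\<forall>x\<in>F. \<forall>y\<in>F. x \<noteq> y \<longrightarrow> r \<le> D x y)" for F
  have card_le: "card F \<le> nat \<lfloor>measure M (space M) / c\<rfloor>" if F: "sep F" for F
  proof -
    have FM: "F \<subseteq> space M" and fin: "finite F" using F X by (auto simp: sep_def)
    have "D_ball x s \<inter> D_ball y s = {}" if xy: "x \<in> F" "y \<in> F" "x \<noteq> y" for x y
    proof (rule ccontr)
      assume "D_ball x s \<inter> D_ball y s \<noteq> {}"
      then obtain z where "z \<in> space M" "D x z < s" "D y z < s" by (auto simp: D_ball_def)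
      moreover have "x \<in> space M" "y \<in> space M" using xy FM by blast+
      ultimately have "D x y < r"
        using D_triangle[of x z y] D_commute[of z y] \<open>2 * s \<le> r\<close> by simp
      moreover have "r \<le> D x y" using F xy unfolding sep_def by blast
      ultimately show False by simp
    qed
    then have "disjoint_family_on (\<lambda>x. D_ball x s) F"
      by (auto simp: disjoint_family_on_def)
    then have "(\<Sum>x\<in>F. measure M (D_ball x s)) = measure M (\<Union>x\<in>F. D_ball x s)"
      using fin FM D_ball_sets by (intro finite_measure_finite_Union[symmetric]) auto
    also have "\<dots> \<le> measure M (space M)"
      by (rule bounded_measure)
    finally have "(\<Sum>x\<in>F. measure M (D_ball x s)) \<le> measure M (space M)" .
    moreover have "(\<Sum>x\<in>F. c) \<le> (\<Sum>x\<in>F. measure M (D_ball x s))"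
      using F c by (intro sum_mono) (auto simp: sep_def intro: less_imp_le)
    ultimately have "real (card F) \<le> measure M (space M) / c"
      using \<open>0 < c\<close> by (simp add: field_simps)
    then show ?thesis by (simp add: le_nat_floor)
  qed
  have "sep {}" by (simp add: sep_def)
  moreover have "\<forall>F. sep F \<longrightarrow> card F < Suc (nat \<lfloor>measure M (space M) / c\<rfloor>)"
    using card_le by (simp add: less_Suc_eq_le)
  ultimately have "\<exists>F. sep F \<and> (\<forall>F'. sep F' \<longrightarrow> card F' \<le> card F)"
    by (rule ex_has_greatest_nat)
  then obtain F where F: "sep F" and max: "\<forall>F'. sep F' \<longrightarrow> card F' \<le> card F"
    by (elim exE conjE)
  have "\<exists>y\<in>F. D y x < r" if x: "x \<in> X" for x
  proof (rule ccontr)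
    assume far: "\<not> (\<exists>y\<in>F. D y x < r)"
    show False
    proof (cases "x \<in> F")
      case False
      have "r \<le> D a b" if ab: "a \<in> insert x F" "b \<in> insert x F" "a \<noteq> b" for a b
      proof -
        have "r \<le> D y x" if "y \<in> F" for y using far that by (simp add: not_less)
        then show ?thesis using ab F D_commute[of x] unfolding sep_def by (metis insertE)
      qed
      then have "sep (insert x F)"
        using F x unfolding sep_def by simp
      then show False
        using spec[OF max, of "insert x F"] False F by (simp add: sep_def)
    next
      case True
      \<comment> \<open>If \<open>x\<close> itself lies in \<open>F\<close>, only
        \<open>0 < r\<close> is missing; it follows because a nonempty ball has a positive radius
        \<open>s\<close>.\<close>
      have "measure M (D_ball x s) > 0" using c[OF x] \<open>0 < c\<close> by linarith
      then have "D_ball x s \<noteq> {}" by force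
      then obtain y where "y \<in> space M" "D x y < s" by (auto simp: D_ball_def)
      moreover have xM: "x \<in> space M" using x X by blast
      ultimately have "0 < s"
        using D_nonneg[of x y] by simp
      then have "D x x < r"
        using \<open>2 * s \<le> r\<close> xM by simp
      then show False using far True by blast
    qed
  qed
  then show ?thesis using F by (auto simp: sep_def)
qed

lemma dense_orbit:
  assumes X: "X \<in> sets M" "emeasure M (space M - X) = 0"
    and balls: "\<And>x r. x \<in> X \<Longrightarrow> 0 < r \<Longrightarrow> 0 < measure M (D_ball x r)"
    and nets: "\<And>r. 0 < r \<Longrightarrow> \<exists>F. finite F \<and> F \<subseteq> X \<and> (\<forall>x\<in>X. \<exists>y\<in>F. D y x < r)"
  shows "\<exists>x0\<in>X. \<forall>x\<in>X. \<forall>r>0. \<forall>m. \<exists>n\<ge>m. D ((T ^^ n) x0) x < r"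
proof -
  have XM: "X \<subseteq> space M" by (rule sets.sets_into_space[OF X(1)])
  \<comment> \<open>The points that enter the ball at some time from \<open>m\<close> on.
    \<open>T\<close> maps the complement into itself, and \<open>V m p r\<close> contains a preimage
    of the ball, so by ergodicity it is conull.\<close>
  define V where "V m p r = {x \<in> space M. \<exists>n. (T ^^ (m + n)) x \<in> D_ball p r}" for m p r
  have V_sets: "V m p r \<in> sets M" if "p \<in> X" for m p r
  proof -
    have "V m p r = (\<Union>n. (T ^^ (m + n)) -` D_ball p r \<inter> space M)"
      by (auto simp: V_def)
    moreover have "(T ^^ (m + n)) -` D_ball p r \<inter> space M \<in> sets M" for n
      using that XM by (intro measurable_sets[OF funpow_measurable] D_ball_sets) auto
    ultimately show ?thesis by (simp only: sets.countable_UN image_subsetI)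
  qed
  have visit: "AE x in M. x \<in> V m p r" if p: "p \<in> X" and r: "0 < r" for m p r
  proof -
    have pM: "p \<in> space M" using p XM by blast
    have "T x \<in> space M - V m p r" if x: "x \<in> space M - V m p r" for x
    proof -
      have "(T ^^ (m + Suc n)) x \<notin> D_ball p r" for n
        using x unfolding V_def by blast
      then have "(T ^^ (m + n)) (T x) \<notin> D_ball p r" for n
        by (simp add: funpow_swap1)
      then have "T x \<notin> V m p r"
        unfolding V_def by blast
      then show ?thesis using x by simp
    qed
    then have "emeasure M (space M - V m p r) = 0 \<or> emeasure M (space M - (space M - V m p r)) = 0"
      using V_sets[OF p] by (intro ergodic_subinvariant[OF ergodic]) auto
    moreover have "emeasure M (space M - (space M - V m p r)) \<noteq> 0"
    proof -
      have "(T ^^ m) -` D_ball p r \<inter> space M \<subseteq> V m p r"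
        by (auto simp: V_def intro!: exI[of _ 0])
      then have "emeasure M (D_ball p r) \<le> emeasure M (V m p r)"
        using emeasure_mono[OF _ V_sets[OF p]] funpow_preserves_measure[OF D_ball_sets[OF pM]] by metis
      moreover have "0 < emeasure M (D_ball p r)"
        using balls[OF p r] by (simp add: emeasure_eq_measure)
      moreover have "space M - (space M - V m p r) = V m p r" by (auto simp: V_def)
      ultimately show ?thesis by simp
    qed
    ultimately have "emeasure M (space M - V m p r) = 0" by blast
    then show ?thesis by (rule null_complement_AE[OF V_sets[OF p]])
  qed
  \<comment> \<open>Centres taken from countably many finite nets serve for all balls, so only
    countably many null sets are discarded.\<close>
  have "\<exists>F. \<forall>k. finite (F k) \<and> F k \<subseteq> X \<and> (\<forall>x\<in>X. \<exists>y\<in>F k. D y x < 1 / real (Suc k))"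
    using nets by (intro choice allI) simp
  then obtain F where F: "\<And>k. finite (F k)" "\<And>k. F k \<subseteq> X"
    "\<And>k x. x \<in> X \<Longrightarrow> \<exists>y\<in>F k. D y x < 1 / real (Suc k)"
    by blast
  have "AE x in M. \<forall>p\<in>F k. x \<in> V m p (1 / real (Suc k))" for k m
    by (intro AE_finite_allI F(1) visit subsetD[OF F(2)]) auto
  then have "AE x in M. \<forall>k. \<forall>m. \<forall>p\<in>F k. x \<in> V m p (1 / real (Suc k))"
    by (simp only: AE_all_countable simp_thms)
  moreover have "AE x in M. x \<in> X"
    by (rule null_complement_AE[OF X])
  ultimately have "AE x in M. x \<in> X \<and> (\<forall>k. \<forall>m. \<forall>p\<in>F k. x \<in> V m p (1 / real (Suc k)))"
    by (rule AE_conjI[rotated])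
  then have "\<exists>x0\<in>space M. x0 \<in> X \<and> (\<forall>k. \<forall>m. \<forall>p\<in>F k. x0 \<in> V m p (1 / real (Suc k)))"
  proof (rule contrapos_pp)
    assume "\<not> (\<exists>x0\<in>space M. x0 \<in> X \<and> (\<forall>k. \<forall>m. \<forall>p\<in>F k. x0 \<in> V m p (1 / real (Suc k))))"
    then have "{x \<in> space M. \<not> (x \<in> X \<and> (\<forall>k. \<forall>m. \<forall>p\<in>F k. x \<in> V m p (1 / real (Suc k))))} = space M"
      by blast
    then show "\<not> (AE x in M. x \<in> X \<and> (\<forall>k. \<forall>m. \<forall>p\<in>F k. x \<in> V m p (1 / real (Suc k))))"
      using AE_iff_null[of M "\<lambda>x. x \<in> X \<and> (\<forall>k. \<forall>m. \<forall>p\<in>F k. x \<in> V m p (1 / real (Suc k)))"] positive_mass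
      by (simp only: sets.top null_sets_def) auto
  qed
  then obtain x0 where x0: "x0 \<in> X" "\<And>k m p. p \<in> F k \<Longrightarrow> x0 \<in> V m p (1 / real (Suc k))"
    by blast
  have "\<exists>n\<ge>m. D ((T ^^ n) x0) x < r" if x: "x \<in> X" and r: "0 < r" for x r m
  proof -
    obtain k where k: "1 / real (Suc k) < r / 2"
      using nat_approx_posE[of "r / 2"] r by auto
    obtain p where p: "p \<in> F k" "D p x < 1 / real (Suc k)" using F(3)[OF x] by blast
    obtain n where n: "(T ^^ (m + n)) x0 \<in> D_ball p (1 / real (Suc k))"
      using x0(2)[OF p(1), of m] unfolding V_def by blast
    have "D p ((T ^^ (m + n)) x0) < 1 / real (Suc k)" "(T ^^ (m + n)) x0 \<in> space M"
      using n by (simp_all only: D_ball_def mem_Collect_eq)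
    moreover have "p \<in> space M" "x \<in> space M" using p(1) F(2) x XM by blast+
    ultimately have "D ((T ^^ (m + n)) x0) x \<le> D p ((T ^^ (m + n)) x0) + D p x"
      "D p ((T ^^ (m + n)) x0) < 1 / real (Suc k)"
      using D_triangle[of "(T ^^ (m + n)) x0" p x] D_commute[of "(T ^^ (m + n)) x0" p] by simp_all
    then have "D ((T ^^ (m + n)) x0) x < r"
      using p(2) k by linarith
    then show ?thesis by (intro exI[of _ "m + n"]) simp
  qed
  then show ?thesis using x0(1) by blast
qed

end

text \<open>What the rest of the construction needs: measures of balls no longer occur. The late
  visits \<open>n \<ge> m\<close> in \<open>dense\<close>, rather than mere density, are what gives
  recurrence.\<close>

locale dense_orbit_system = non_sensitive_system +
  fixes X :: "'a set" and x0 :: 'a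
  assumes X: "X \<in> sets M" "emeasure M (space M - X) = 0"
    and T_X: "x \<in> X \<Longrightarrow> T x \<in> X"
    and nets: "0 < r \<Longrightarrow> \<exists>F. finite F \<and> F \<subseteq> X \<and> (\<forall>x\<in>X. \<exists>y\<in>F. D y x < r)"
    and x0: "x0 \<in> X"
    and dense: "x \<in> X \<Longrightarrow> 0 < r \<Longrightarrow> \<exists>n\<ge>m. D ((T ^^ n) x0) x < r"

lemma (in non_sensitive_system) dense_orbit_system_ex: "\<exists>X x0. dense_orbit_system M T d X x0"
proof -
  obtain X c where X: "X \<in> sets M" "emeasure M (space M - X) = 0" "\<And>x. x \<in> X \<Longrightarrow> T x \<in> X"
    and c: "\<And>k. 0 < c k" "\<And>x k. x \<in> X \<Longrightarrow> c k < measure M (D_ball x (1 / real (Suc k)))"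
    using uniform_domain by metis
  have XM: "X \<subseteq> space M" by (rule sets.sets_into_space[OF X(1)])
  have balls: "0 < measure M (D_ball x r)" if x: "x \<in> X" "0 < r" for x r
  proof -
    obtain k where k: "1 / real (Suc k) < r"
      using nat_approx_posE[OF x(2)] by blast
    have "measure M (D_ball x (1 / real (Suc k))) \<le> measure M (D_ball x r)"
      using k x(1) XM by (intro finite_measure_mono D_ball_sets) (auto simp: D_ball_def)
    then show ?thesis
      using c(1)[of k] c(2)[OF x(1), of k] by linarith
  qed
  have nets: "\<exists>F. finite F \<and> F \<subseteq> X \<and> (\<forall>x\<in>X. \<exists>y\<in>F. D y x < r)" if r: "0 < r" for r
  proof -
    obtain k where k: "1 / real (Suc k) < r / 2"
      using nat_approx_posE[OF half_gt_zero[OF r]] by blast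
    show ?thesis
      by (rule finite_D_net[OF XM c(1) c(2)[of _ k]]) (use k in auto)
  qed
  obtain x0 where "x0 \<in> X" "\<And>x r m. x \<in> X \<Longrightarrow> 0 < r \<Longrightarrow> \<exists>n\<ge>m. D ((T ^^ n) x0) x < r"
    using dense_orbit[OF X(1,2) balls nets] by blast
  then have "dense_orbit_system M T d X x0"
    using X nets by unfold_locales auto
  then show ?thesis by blast
qed

text \<open>The index type of a space of bounded continuous functions must be metric for the space to be
  complete; the topology of \<^typ>\<open>nat\<close> is the discrete one anyway.\<close>

instantiation nat :: metric_space
begin

definition dist_nat :: "nat \<Rightarrow> nat \<Rightarrow> real" where
  "dist_nat m n = \<bar>real m - real n\<bar>"

definition uniformity_nat :: "(nat \<times> nat) filter" where
  "uniformity_nat = (INF e\<in>{0<..}. principal {(x, y). dist x y < e})"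

instance
proof
  fix U :: "nat set"
  have "\<forall>\<^sub>F (x, y) in uniformity. x = (y :: nat)"
    unfolding uniformity_nat_def
    by (rule eventually_INF1[of 1]) (auto simp: eventually_principal dist_nat_def)
  then have "\<forall>\<^sub>F (x', y) in uniformity. x' = x \<longrightarrow> y \<in> U" if "x \<in> U" for x
    by (rule eventually_mono) (use that in auto)
  then show "open U \<longleftrightarrow> (\<forall>x\<in>U. \<forall>\<^sub>F (x', y) in uniformity. x' = x \<longrightarrow> y \<in> U)"
    by (auto simp: open_discrete)
qed (auto simp: dist_nat_def uniformity_nat_def)

end

section \<open>An invariant metric on the integers\<close>

context dense_orbit_system
begin

lemma X_space: "X \<subseteq> space M"
  by (rule sets.sets_into_space[OF X(1)])

lemma X_in_space [simp]: "x \<in> X \<Longrightarrow> x \<in> space M"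
  using X_space by blast

definition orbit_point :: "nat \<Rightarrow> 'a" where
  "orbit_point n = (T ^^ n) x0"

lemma orbit_point_in_X [simp]: "orbit_point n \<in> X"
  by (induction n) (auto simp: orbit_point_def x0 T_X)

lemma orbit_point_0: "orbit_point 0 = x0"
  by (simp add: orbit_point_def)

lemma orbit_point_Suc: "orbit_point (Suc n) = T (orbit_point n)"
  by (simp add: orbit_point_def)

lemma orbit_point_dense: "x \<in> X \<Longrightarrow> 0 < r \<Longrightarrow> \<exists>n\<ge>m. D (orbit_point n) x < r"
  using dense by (simp add: orbit_point_def)

lemma D_orbit_point_add_le: "D (orbit_point (a + n)) (orbit_point (b + n)) \<le> D (orbit_point a) (orbit_point b)"
proof (induction n)
  case (Suc n)
  then show ?case
    using D_T_le[of "orbit_point (a + n)" "orbit_point (b + n)"] by (simp add: orbit_point_Suc)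
qed simp

text \<open>Along a recurrence time the contraction comes back almost to where it started, so it cannot
  have lost anything.\<close>
lemma D_orbit_point_Suc: "D (orbit_point (Suc a)) (orbit_point (Suc b)) = D (orbit_point a) (orbit_point b)"
proof (rule antisym)
  show "D (orbit_point (Suc a)) (orbit_point (Suc b)) \<le> D (orbit_point a) (orbit_point b)"
    using D_orbit_point_add_le[of a 1 b] by simp
  show "D (orbit_point a) (orbit_point b) \<le> D (orbit_point (Suc a)) (orbit_point (Suc b))"
  proof (rule field_le_epsilon)
    fix r :: real assume "0 < r"
    then obtain n where n: "n \<ge> 1" "D (orbit_point n) (orbit_point 0) < r / 2"
      using orbit_point_dense[of "orbit_point 0" "r / 2" 1] by auto
    have near: "D (orbit_point (c + n)) (orbit_point c) < r / 2" for c
      using D_orbit_point_add_le[of n c 0] n(2) by (simp add: add.commute)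
    \<comment> \<open>As \<open>n\<close> is at least 1, a first step can be split off; the
      remaining \<open>k\<close> steps do not increase \<open>D\<close>.\<close>
    obtain k where k: "n = Suc k" using n(1) by (cases n) auto
    have "D (orbit_point (a + n)) (orbit_point (b + n)) \<le> D (orbit_point (Suc a)) (orbit_point (Suc b))"
      using D_orbit_point_add_le[of "Suc a" k "Suc b"] k by simp
    moreover have "D (orbit_point a) (orbit_point b) \<le> D (orbit_point a) (orbit_point (a + n)) + D (orbit_point (a + n)) (orbit_point b)"
      by (intro D_triangle) auto
    moreover have "D (orbit_point (a + n)) (orbit_point b) \<le> D (orbit_point (a + n)) (orbit_point (b + n)) + D (orbit_point (b + n)) (orbit_point b)"
      by (intro D_triangle) auto
    ultimately show "D (orbit_point a) (orbit_point b) \<le> D (orbit_point (Suc a)) (orbit_point (Suc b)) + r"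
      using near[of a] near[of b] D_commute[of "orbit_point a" "orbit_point (a + n)"] by linarith
  qed
qed

text \<open>The length function of the invariant metric on the integers. The absolute value takes
  care of negative times, at which the orbit has no points.\<close>

definition shift_norm :: "int \<Rightarrow> real" where
  "shift_norm z = D (orbit_point (nat \<bar>z\<bar>)) x0"

lemma D_orbit_point: "D (orbit_point a) (orbit_point b) = shift_norm (int a - int b)"
proof -
  have add: "D (orbit_point (a + n)) (orbit_point (b + n)) = D (orbit_point a) (orbit_point b)" for a b n
    by (induction n) (simp_all add: D_orbit_point_Suc)
  show ?thesis
  proof (cases "b \<le> a")
    case True
    then show ?thesis
      using add[of "a - b" b 0] by (simp add: shift_norm_def orbit_point_0 nat_diff_distrib)
  next
    case False
    then have "nat \<bar>int a - int b\<bar> = b - a" by simp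
    then show ?thesis
      using False add[of 0 a "b - a"] D_commute by (simp add: shift_norm_def orbit_point_0)
  qed
qed

text \<open>Adding a large \<open>k\<close> turns both integers into times on the orbit, where the
  triangle inequality of \<open>D\<close> applies.\<close>

lemma int_pair: "\<exists>i j k. u = int i - int k \<and> v = int j - int k"
proof (intro exI conjI)
  let ?k = "nat (\<bar>u\<bar> + \<bar>v\<bar>)"
  show "u = int (nat (u + int ?k)) - int ?k" "v = int (nat (v + int ?k)) - int ?k" by auto
qed

lemma shift_norm_triangle: "shift_norm u \<le> shift_norm v + shift_norm (u - v)"
proof -
  obtain i j k where uv: "u = int i - int k" "v = int j - int k" using int_pair by blast
  have "D (orbit_point i) (orbit_point k) \<le> D (orbit_point i) (orbit_point j) + D (orbit_point j) (orbit_point k)"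
    by (intro D_triangle) auto
  moreover have "u - v = int i - int j" using uv by simp
  ultimately show ?thesis by (simp add: D_orbit_point uv)
qed

lemma shift_norm_minus: "shift_norm (- u) = shift_norm u"
  by (simp add: shift_norm_def)

lemma shift_norm_diff_le: "\<bar>shift_norm u - shift_norm v\<bar> \<le> shift_norm (u - v)"
  using shift_norm_triangle[of u v] shift_norm_triangle[of v u] shift_norm_minus[of "u - v"] by simp

lemma shift_norm_range: "0 \<le> shift_norm u" "shift_norm u \<le> 1"
  using x0 by (auto simp: shift_norm_def intro: D_nonneg D_le_1)

lemma shift_norm_0 [simp]: "shift_norm 0 = 0"
  using x0 by (simp add: shift_norm_def orbit_point_0)

lemma shift_norm_recurrent: "0 < r \<Longrightarrow> \<exists>n\<ge>m. shift_norm (int n) < r"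
  using orbit_point_dense[of x0 r m] x0 by (auto simp: shift_norm_def)

text \<open>A point is a sublevel set of a measurable distance function, hence measurable; with
  positive measure it would be an atom.\<close>

lemma singleton_null: "x \<in> space M \<Longrightarrow> {x} \<in> sets M \<and> emeasure M {x} = 0"
proof -
  assume x: "x \<in> space M"
  have "{y \<in> space M. D y x \<le> 0} \<in> sets M"
    by (intro borel_measurable_le D_fiber_measurable x borel_measurable_const)
  moreover have "{y \<in> space M. D y x \<le> 0} = {x}"
    using x D_eq_0[of _ x] D_nonneg[of _ x] by (auto intro: antisym)
  ultimately have sets: "{x} \<in> sets M" by simp
  moreover have "emeasure M {x} = 0"
  proof (rule ccontr)
    assume "emeasure M {x} \<noteq> 0"
    then have "0 < emeasure M {x}" by (simp add: zero_less_iff_neq_zero)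
    then obtain B where "B \<subseteq> {x}" "0 < emeasure M B" "emeasure M B < emeasure M {x}"
      using nonatomic sets unfolding nonatomic_def by blast
    then show False by (auto simp: subset_singleton_iff)
  qed
  ultimately show ?thesis by simp
qed

lemma X_infinite: "infinite X"
proof
  assume fin: "finite X"
  then have "emeasure M X = (\<Sum>x\<in>X. emeasure M {x})"
    using singleton_null by (intro emeasure_eq_sum_singleton) auto
  also have "\<dots> = 0" using singleton_null by (intro sum.neutral) auto
  finally have "emeasure M X = 0" .
  moreover have "emeasure M (space M) \<le> emeasure M X + emeasure M (space M - X)"
    using X(1) by (intro order_trans[OF _ emeasure_subadditive] emeasure_mono) auto
  ultimately show False using positive_mass X(2) by simp
qed

text \<open>A nonzero time of length 0 would make the orbit periodic, hence finite. Being dense, it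
  would then exhaust \<open>X\<close>, which is infinite since points are null.\<close>

lemma shift_norm_pos:
  assumes "z \<noteq> 0"
  shows "0 < shift_norm z"
proof (rule ccontr)
  assume "\<not> 0 < shift_norm z"
  define n where "n = nat \<bar>z\<bar>"
  have "0 < n" using assms by (simp add: n_def)
  have "D (orbit_point n) x0 = 0"
    using \<open>\<not> 0 < shift_norm z\<close> shift_norm_range(1)[of z] by (simp add: shift_norm_def n_def)
  then have "orbit_point n = x0" using x0 by (intro D_eq_0) auto
  then have period: "orbit_point (k + n) = orbit_point k" for k
    by (induction k) (simp_all add: orbit_point_Suc orbit_point_0)
  have orbit_point_mem: "orbit_point k \<in> orbit_point ` {..<n}" for k
  proof (induction k rule: less_induct)
    case (less k)
    show ?case
    proof (cases "k < n")
      case False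
      then have "orbit_point k = orbit_point (k - n)" using period[of "k - n"] by simp
      then show ?thesis using less[of "k - n"] False \<open>0 < n\<close> by simp
    qed simp
  qed
  have "X \<subseteq> orbit_point ` {..<n}"
  proof
    fix x assume x: "x \<in> X"
    show "x \<in> orbit_point ` {..<n}"
    proof (rule ccontr)
      assume x': "x \<notin> orbit_point ` {..<n}"
      \<comment> \<open>The least distance from \<open>x\<close> to the finite orbit, which density
        of the orbit has to undercut.\<close>
      let ?m = "Min ((\<lambda>y. D y x) ` orbit_point ` {..<n})"
      have "0 < D y x" if y: "y \<in> orbit_point ` {..<n}" for y
      proof -
        have "y \<in> space M" "x \<in> space M" "y \<noteq> x" using y x x' by auto
        then show ?thesis using D_nonneg[of y x] D_eq_0[of y x] by fastforce
      qed
      then have "0 < ?m" using \<open>0 < n\<close> by (subst Min_gr_iff) auto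
      then obtain k where "D (orbit_point k) x < ?m" using orbit_point_dense[OF x] by blast
      moreover have "?m \<le> D (orbit_point k) x" using orbit_point_mem by (intro Min_le) auto
      ultimately show False by simp
    qed
  qed
  then show False using X_infinite finite_subset by blast
qed

section \<open>The Kronecker factor is the whole system\<close>

text \<open>The Kuratowski embedding by distances to the dense orbit. Its target, the bounded
  sequences with the supremum norm, is complete and receives the integers too.\<close>

definition embed :: "'a \<Rightarrow> nat \<Rightarrow>\<^sub>C real" where
  "embed x = Bcontfun (\<lambda>b. D x (orbit_point b))"

text \<open>The same sequence of distances for the possibly fictitious orbit point at time
  \<open>z\<close>, which may be negative.\<close>

definition shift_point :: "int \<Rightarrow> nat \<Rightarrow>\<^sub>C real" where
  "shift_point z = Bcontfun (\<lambda>b. shift_norm (z - int b))"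

lemma embed_apply [simp]: "x \<in> space M \<Longrightarrow> apply_bcontfun (embed x) b = D x (orbit_point b)"
  unfolding embed_def
  by (subst Bcontfun_inverse)
    (auto simp: bcontfun_def D_nonneg D_le_1 intro!: boundedI[of _ 1])

lemma shift_point_apply [simp]: "apply_bcontfun (shift_point z) b = shift_norm (z - int b)"
  unfolding shift_point_def
  by (subst Bcontfun_inverse)
    (auto simp: bcontfun_def shift_norm_range intro!: boundedI[of _ 1])

lemma shift_point_eq_embed: "shift_point (int n) = embed (orbit_point n)"
  by (rule bcontfun_eqI) (simp add: D_orbit_point)

lemma dist_embed:
  assumes "x \<in> X" "y \<in> X"
  shows "dist (embed x) (embed y) = D x y"
proof (rule antisym)
  show "dist (embed x) (embed y) \<le> D x y"
  proof (rule dist_bound)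
    fix b
    show "dist (embed x b) (embed y b) \<le> D x y"
      using D_triangle[of x y "orbit_point b"] D_triangle[of y x "orbit_point b"] D_commute[of x y] assms
      by (simp add: dist_real_def)
  qed
  show "D x y \<le> dist (embed x) (embed y)"
  proof (rule field_le_epsilon)
    fix r :: real assume "0 < r"
    \<comment> \<open>The coordinate at an orbit point close to \<open>x\<close> nearly attains the
      distance.\<close>
    then obtain n where n: "D (orbit_point n) x < r / 2"
      using orbit_point_dense[OF assms(1), of "r / 2"] by auto
    have "D x y \<le> D x (orbit_point n) + D (orbit_point n) y"
      using assms by (intro D_triangle) auto
    moreover have "D y (orbit_point n) - D x (orbit_point n) \<le> dist (embed x) (embed y)"
      using dist_bounded[of "embed x" n "embed y"] assms by (simp add: dist_real_def)
    ultimately show "D x y \<le> dist (embed x) (embed y) + r"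
      using n D_commute[of x "orbit_point n"] D_commute[of y "orbit_point n"] by linarith
  qed
qed

text \<open>Coordinates exist only at nonnegative times, so the coordinate that should sit at
  \<open>b\<close> is taken at \<open>b + m\<close>, with \<open>m\<close> a return time beyond
  \<open>- b\<close>.\<close>

lemma dist_shift_point: "dist (shift_point a) (shift_point b) = shift_norm (a - b)"
proof (rule antisym)
  show "dist (shift_point a) (shift_point b) \<le> shift_norm (a - b)"
  proof (rule dist_bound)
    show "dist (shift_point a c) (shift_point b c) \<le> shift_norm (a - b)" for c
      using shift_norm_diff_le[of "a - int c" "b - int c"] by (simp add: dist_real_def)
  qed
  show "shift_norm (a - b) \<le> dist (shift_point a) (shift_point b)"
  proof (rule field_le_epsilon)
    fix r :: real assume "0 < r"
    then obtain m where m: "m \<ge> nat (- b)" "shift_norm (int m) < r / 2"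
      using shift_norm_recurrent[of "r / 2"] by auto
    define c where "c = nat (b + int m)"
    have c: "int c = b + int m" using m(1) by (simp add: c_def)
    have "shift_norm (a - int c) - shift_norm (b - int c) \<le> dist (shift_point a) (shift_point b)"
      using dist_bounded[of "shift_point a" c "shift_point b"] by (simp add: dist_real_def)
    moreover have "shift_norm (b - int c) = shift_norm (int m)"
      using shift_norm_minus[of "int m"] by (simp add: c)
    moreover have "shift_norm (a - b) \<le> shift_norm (a - int c) + shift_norm (int m)"
      using shift_norm_triangle[of "a - b" "a - int c"] by (simp add: c)
    ultimately show "shift_norm (a - b) \<le> dist (shift_point a) (shift_point b) + r"
      using m(2) by linarith
  qed
qed

lemma compact_closure_shift_point: "compact (closure (range shift_point))"
  unfolding compact_eq_totally_bounded
proof (intro conjI allI impI)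
  show "complete (closure (range shift_point))" by (simp add: complete_eq_closed)
  fix r :: real assume r: "0 < r"
  then obtain F where F: "finite F" "F \<subseteq> X" "\<And>x. x \<in> X \<Longrightarrow> \<exists>y\<in>F. D y x < r / 3"
    using nets[of "r / 3"] by auto
  have "closure (range shift_point) \<subseteq> (\<Union>k\<in>embed ` F. ball k r)"
  proof
    fix k assume "k \<in> closure (range shift_point)"
    then have "\<exists>y\<in>range shift_point. dist y k < r / 3"
      using closure_approachable[of k "range shift_point"] r by (metis divide_pos_pos zero_less_numeral)
    then obtain z where z: "dist (shift_point z) k < r / 3" by blast
    \<comment> \<open>A return time moves \<open>z\<close> to a nonnegative time, whose point lies
      in the image of \<open>X\<close> and so near the net. The closure, the return and the net each
      contribute an error of \<open>r / 3\<close>.\<close>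
    obtain m where m: "m \<ge> nat (- z)" "shift_norm (int m) < r / 3"
      using shift_norm_recurrent[of "r / 3"] r by auto
    define n where "n = nat (z + int m)"
    have n: "int n = z + int m" using m(1) by (simp add: n_def)
    obtain y where y: "y \<in> F" "D y (orbit_point n) < r / 3" using F(3)[OF orbit_point_in_X] by blast
    have "dist (embed y) (shift_point (int n)) < r / 3"
      using y F(2) by (simp add: shift_point_eq_embed dist_embed subset_iff)
    moreover have "dist (shift_point (int n)) (shift_point z) < r / 3"
      using m(2) by (simp add: dist_shift_point n)
    ultimately have "dist (embed y) k < r"
      using z dist_triangle[of "embed y" k "shift_point (int n)"] dist_triangle[of "shift_point (int n)" k "shift_point z"] by linarith
    then show "k \<in> (\<Union>k\<in>embed ` F. ball k r)" using y(1) by auto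
  qed
  then show "\<exists>k. finite k \<and> closure (range shift_point) \<subseteq> (\<Union>x\<in>k. ball x r)"
    using F(1) by (intro exI[of _ "embed ` F"]) simp
qed

sublocale orbit: translation_invariant_integers shift_point
proof
  show "inj shift_point"
  proof (rule injI, rule ccontr)
    fix a b assume "shift_point a = shift_point b" "a \<noteq> b"
    then show False using dist_shift_point[of a b] shift_norm_pos[of "a - b"] by simp
  qed
qed (simp_all add: dist_shift_point compact_closure_shift_point shift_norm_recurrent)

lemma embed_near_shift_point: "x \<in> X \<Longrightarrow> 0 < r \<Longrightarrow> \<exists>n. dist (shift_point (int n)) (embed x) < r"
  using orbit_point_dense[of x r] by (auto simp: shift_point_eq_embed dist_embed)

lemma embed_in_K [simp]: "x \<in> X \<Longrightarrow> embed x \<in> orbit.K"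
  unfolding closure_approachable using embed_near_shift_point by blast

text \<open>At orbit points this is addition of 1 in the integers. It extends to \<open>X\<close>
  because \<open>T\<close> does not expand \<open>D\<close> and the rotation is an isometry.\<close>

lemma embed_T:
  assumes x: "x \<in> X"
  shows "embed (T x) = orbit.add (shift_point 1, embed x)"
proof -
  have "dist (embed (T x)) (orbit.add (shift_point 1, embed x)) \<le> 0"
  proof (rule field_le_epsilon)
    fix r :: real assume "0 < r"
    then obtain n where n: "D (orbit_point n) x < r / 2"
      using orbit_point_dense[OF x, of "r / 2"] by auto
    have "D (orbit_point (Suc n)) (T x) < r / 2"
      using D_T_le[of "orbit_point n" x] n x by (simp add: orbit_point_Suc)
    then have "dist (embed (T x)) (shift_point (1 + int n)) < r / 2"
      using x T_X shift_point_eq_embed[of "Suc n"] by (simp add: dist_embed D_commute)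
    moreover have "dist (orbit.add (shift_point 1, shift_point (int n))) (orbit.add (shift_point 1, embed x)) < r / 2"
      using n x by (subst orbit.dist_add) (simp_all add: shift_point_eq_embed dist_embed)
    ultimately show "dist (embed (T x)) (orbit.add (shift_point 1, embed x)) \<le> 0 + r"
      using dist_triangle[of "embed (T x)" "orbit.add (shift_point 1, embed x)" "shift_point (1 + int n)"] by simp
  qed
  then show ?thesis by simp
qed

text \<open>The sequences of \<open>embed\<close>, now in the product topology. Unlike the supremum
  norm on bounded sequences it is second countable, so inner regularity applies and measurability
  can be checked coordinatewise.\<close>

definition coords :: "'a \<Rightarrow> nat \<Rightarrow> real" where
  "coords x b = D x (orbit_point b)"

lemma coords_measurable: "coords \<in> borel_measurable M"
  by (rule measurable_coordinatewise_then_product) (simp add: coords_def D_fiber_measurable)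

lemma inj_on_embed: "inj_on embed X"
proof (rule inj_onI)
  fix x y assume "x \<in> X" "y \<in> X" "embed x = embed y"
  then show "x = y" using dist_embed[of x y] D_eq_0[of x y] by simp
qed

lemma apply_embed: "x \<in> X \<Longrightarrow> apply_bcontfun (embed x) = coords x"
  by (rule ext) (simp add: coords_def)

lemma inj_on_coords: "inj_on coords X"
  using inj_on_embed apply_embed by (metis apply_bcontfun_inject inj_on_def)

lemma continuous_on_apply_bcontfun_arg: "continuous_on S (apply_bcontfun :: (nat \<Rightarrow>\<^sub>C real) \<Rightarrow> nat \<Rightarrow> real)"
proof (intro continuous_on_coordinatewise_then_product)
  show "continuous_on S (\<lambda>f :: nat \<Rightarrow>\<^sub>C real. f i)" for i
    by (rule continuous_on_iff[THEN iffD2]) (meson dist_fun_lt_imp_dist_val_lt)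
qed

text \<open>A default value in \<open>K\<close> off the conull set \<open>X\<close> makes the map
  total, so that \<open>M\<close> can be pushed forward along it.\<close>

definition to_group :: "'a \<Rightarrow> nat \<Rightarrow>\<^sub>C real" where
  "to_group x = (if x \<in> X then embed x else shift_point 0)"

lemma to_group_in_K [simp]: "to_group x \<in> orbit.K"
  by (simp add: to_group_def)

text \<open>On the compact set \<open>K\<close> the coordinate map is injective and continuous, so
  its inverse is continuous: the supremum norm and the product topology agree there, and measurable
  coordinates suffice.\<close>

lemma to_group_measurable: "to_group \<in> M \<rightarrow>\<^sub>M restrict_space borel orbit.K"
proof -
  let ?J = "apply_bcontfun :: (nat \<Rightarrow>\<^sub>C real) \<Rightarrow> nat \<Rightarrow> real"
  define h where "h = inv_into UNIV ?J"
  have hJ: "h (?J k) = k" for k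
    unfolding h_def by (rule inv_f_f) (auto simp: inj_def apply_bcontfun_inject)
  have "continuous_on (?J ` orbit.K) h"
    by (rule continuous_on_inv[OF continuous_on_apply_bcontfun_arg compact_closure_shift_point]) (simp add: hJ)
  then have h: "h \<in> borel_measurable (restrict_space borel (?J ` orbit.K))"
    by (rule borel_measurable_continuous_on_restrict)
  have "(\<lambda>x. if x \<in> X then coords x else ?J (shift_point 0)) \<in> borel_measurable M"
    using X(1) coords_measurable by (intro measurable_If_set) auto
  moreover have "?J (to_group x) = (if x \<in> X then coords x else ?J (shift_point 0))" for x
    by (simp add: to_group_def apply_embed)
  ultimately have "(\<lambda>x. ?J (to_group x)) \<in> borel_measurable M" by simp
  then have "(\<lambda>x. ?J (to_group x)) \<in> M \<rightarrow>\<^sub>M restrict_space borel (?J ` orbit.K)"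
    by (intro measurable_restrict_space2) auto
  from measurable_compose[OF this h] have "to_group \<in> borel_measurable M"
    by (simp add: hJ)
  then show ?thesis
    by (intro measurable_restrict_space2) auto
qed

section \<open>The image measure and the isomorphism\<close>

definition N :: "(nat \<Rightarrow>\<^sub>C real) measure" where
  "N = distr M (restrict_space borel orbit.K) to_group"

lemma sets_N: "sets N = sets (restrict_space borel orbit.K)"
  by (simp add: N_def)

lemma space_N: "space N = orbit.K"
  by (simp add: N_def space_restrict_space)

lemma to_group_measurable_N: "to_group \<in> M \<rightarrow>\<^sub>M N"
  using to_group_measurable measurable_cong_sets[OF refl sets_N] by blast

lemma emeasure_N: "A \<in> sets N \<Longrightarrow> emeasure N A = emeasure M (to_group -` A \<inter> space M)"
  using emeasure_distr[OF to_group_measurable] unfolding sets_N by (simp add: N_def)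

lemma emeasure_N_space: "emeasure N (space N) = emeasure M (space M)"
proof -
  have "to_group -` space N \<inter> space M = space M" by (auto simp: space_N)
  then show ?thesis using emeasure_N[OF sets.top] by simp
qed

lemma AE_X: "AE x in M. x \<in> X"
  by (rule null_complement_AE[OF X])

text \<open>On \<open>X\<close> the map \<open>to_group\<close> intertwines \<open>T\<close> with
  the rotation by 1, so invariance of \<open>M\<close> passes to the image measure;
  \<open>Haar_measureI\<close> does the rest.\<close>

lemma Haar_N: "Haar_measure orbit.G (top_of_set orbit.K) N"
proof (rule orbit.Haar_measureI)
  show "finite_measure N"
    by (rule finite_measureI) (simp add: emeasure_N_space)
  show "0 < emeasure N (space N)"
    using positive_mass by (simp add: emeasure_N_space)
  show "sets N = sets (restrict_space borel orbit.K)" by (rule sets_N)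
  fix A assume A: "A \<in> sets N"
  let ?t = "\<lambda>x. orbit.add (shift_point 1, x)"
  have "continuous_on orbit.K ?t"
    by (intro orbit.continuous_on_add continuous_on_const continuous_on_id) auto
  then have "?t \<in> restrict_space borel orbit.K \<rightarrow>\<^sub>M restrict_space borel orbit.K"
    by (intro measurable_restrict_space2 borel_measurable_continuous_on_restrict)
      (auto simp: space_restrict_space)
  then have "?t \<in> N \<rightarrow>\<^sub>M N"
    using measurable_cong_sets[OF sets_N sets_N] by blast
  from measurable_sets[OF this A] have tA: "?t -` A \<inter> orbit.K \<in> sets N"
    by (simp add: space_N)
  have A': "to_group -` A \<inter> space M \<in> sets M"
    by (rule measurable_sets[OF to_group_measurable_N A])
  have "emeasure N (?t -` A \<inter> orbit.K) = emeasure M (to_group -` (?t -` A \<inter> orbit.K) \<inter> space M)"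
    by (rule emeasure_N[OF tA])
  also have "\<dots> = emeasure M (T -` (to_group -` A \<inter> space M) \<inter> space M)"
  proof (rule emeasure_eq_AE)
    have "x \<in> to_group -` (?t -` A \<inter> orbit.K) \<inter> space M \<longleftrightarrow> x \<in> T -` (to_group -` A \<inter> space M) \<inter> space M"
      if "x \<in> X" for x
      using that embed_T[of x] T_X[of x] by (simp add: to_group_def)
    then show "AE x in M. x \<in> to_group -` (?t -` A \<inter> orbit.K) \<inter> space M \<longleftrightarrow>
        x \<in> T -` (to_group -` A \<inter> space M) \<inter> space M"
      using AE_X by (auto elim: AE_mp)
  qed (use measurable_sets[OF to_group_measurable_N tA] measurable_sets[OF measurable_map A'] in simp_all)
  also have "\<dots> = emeasure N A"
    using preserves_measure[OF A'] emeasure_N[OF A] by simp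
  finally show "emeasure N (?t -` A \<inter> orbit.K) = emeasure N A" .
qed

lemma isomorphic_mod_0_N: "isomorphic_mod_0 M T N (rotation orbit.G (shift_point 1))"
proof -
  obtain B where B: "B \<in> sets M" "B \<subseteq> X" "emeasure M (X - B) = 0" "coords ` B \<in> sets borel"
    and inv: "inv_into B coords \<in> restrict_space borel (coords ` B) \<rightarrow>\<^sub>M M"
    using inj_measurable_imp_bimeasurable_mod_0[OF standard_Borel finite_measure_axioms
        coords_measurable X(1) inj_on_coords] by blast
  have inv_coords: "inv_into B coords (coords x) = x" if "x \<in> B" for x
    by (rule inv_into_f_f[OF inj_on_subset[OF inj_on_coords B(2)] that])
  have AE_B: "AE x in M. x \<in> B"
  proof -
    have "AE x in M. x \<notin> X - B"
      using B X(1) by (intro AE_not_in null_setsI) auto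
    with AE_X show ?thesis by eventually_elim blast
  qed
  \<comment> \<open>\<open>B\<close> need not be mapped into itself by \<open>T\<close>. The points
    whose whole forward orbit stays in \<open>B\<close> form a set that is, and it is still
    conull.\<close>
  define U where "U = {x \<in> space M. \<forall>n. (T ^^ n) x \<in> B}"
  have U_eq: "U = (\<Inter>n. (T ^^ n) -` B \<inter> space M)"
    by (auto simp: U_def)
  have U: "U \<in> sets M"
    unfolding U_eq using measurable_sets[OF funpow_measurable B(1)] by (intro sets.countable_INT) auto
  have UB: "U \<subseteq> B"
    using B(1) by (auto simp: U_def dest!: spec[of _ 0])
  then have UX: "U \<subseteq> X" using B(2) by blast
  have TU: "T x \<in> U" if "x \<in> U" for x
  proof -
    have "(T ^^ n) (T x) \<in> B" for n
      using that unfolding U_def by (auto dest!: spec[of _ "Suc n"] simp: funpow_swap1)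
    then show ?thesis using that by (simp add: U_def)
  qed
  have "AE x in M. (T ^^ n) x \<in> B" for n
  proof -
    have "(T ^^ n) -` (space M - B) \<inter> space M \<in> null_sets M"
      using funpow_preserves_measure[of "space M - B" n] AE_null_complement[OF B(1) AE_B] B(1)
        measurable_sets[OF funpow_measurable, of "space M - B" n]
      by (intro null_setsI) auto
    then have "AE x in M. x \<notin> (T ^^ n) -` (space M - B) \<inter> space M"
      by (rule AE_not_in)
    then show ?thesis by (rule AE_mp) auto
  qed
  then have "AE x in M. \<forall>n. (T ^^ n) x \<in> B" by (simp add: AE_all_countable)
  then have AE_U: "AE x in M. x \<in> U" by (rule AE_mp) (auto simp: U_def)
  have null_U: "emeasure M (space M - U) = 0"
    by (rule AE_null_complement[OF U AE_U])
  let ?J = "apply_bcontfun :: (nat \<Rightarrow>\<^sub>C real) \<Rightarrow> nat \<Rightarrow> real"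
  have to_group_U: "to_group x = embed x" "?J (to_group x) = coords x" if "x \<in> U" for x
    using that UX apply_embed by (auto simp: to_group_def)
  have inj_U: "inj_on to_group U"
    using inj_on_subset[OF inj_on_embed UX] to_group_U(1) by (simp cong: inj_on_cong)
  \<comment> \<open>The image of \<open>U\<close> under \<open>coords\<close>, written through the
    measurable inverse so that it is visibly Borel.\<close>
  define W where "W = {y \<in> coords ` B. inv_into B coords y \<in> U}"
  have W: "W \<in> sets borel"
  proof -
    have "inv_into B coords -` U \<inter> space (restrict_space borel (coords ` B)) \<in> sets (restrict_space borel (coords ` B))"
      by (rule measurable_sets[OF inv U])
    moreover have "inv_into B coords -` U \<inter> space (restrict_space borel (coords ` B)) = W"
      by (auto simp: W_def space_restrict_space)
    ultimately show ?thesis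
      using B(4) by (simp add: sets_restrict_space_iff)
  qed
  have J: "?J \<in> borel_measurable N"
    using borel_measurable_continuous_on_restrict[OF continuous_on_apply_bcontfun_arg[of orbit.K]]
      measurable_cong_sets[OF sets_N refl] by blast
  define V where "V = to_group ` U"
  have V_eq: "V = ?J -` W \<inter> space N"
  proof (intro equalityI subsetI)
    fix k assume "k \<in> V"
    then obtain x where "x \<in> U" "k = to_group x" by (auto simp: V_def)
    then show "k \<in> ?J -` W \<inter> space N"
      using to_group_U(2)[of x] UB inv_coords[of x] by (auto simp: W_def space_N)
  next
    fix k assume k: "k \<in> ?J -` W \<inter> space N"
    then obtain x where x: "x \<in> B" "?J k = coords x" "x \<in> U"
      using inv_coords by (auto simp: W_def)
    then have "?J k = ?J (to_group x)" using to_group_U by simp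
    then have "k = to_group x" by (simp add: apply_bcontfun_inject)
    then show "k \<in> V" using x(3) by (simp add: V_def)
  qed
  have V: "V \<in> sets N"
    unfolding V_eq by (rule measurable_sets[OF J W])
  have VK: "V \<subseteq> orbit.K" by (auto simp: V_def)
  have vimage_AE: "emeasure M (to_group -` A \<inter> U) = emeasure N A" if "A \<in> sets N" for A
    unfolding emeasure_N[OF that]
  proof (rule emeasure_eq_AE)
    show "AE x in M. x \<in> to_group -` A \<inter> U \<longleftrightarrow> x \<in> to_group -` A \<inter> space M"
      using AE_U by (rule AE_mp) auto
    show "to_group -` A \<inter> space M \<in> sets M"
      by (rule measurable_sets[OF to_group_measurable_N that])
    then have "to_group -` A \<inter> space M \<inter> U \<in> sets M" using U by blast
    moreover have "to_group -` A \<inter> space M \<inter> U = to_group -` A \<inter> U" using UX by auto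
    ultimately show "to_group -` A \<inter> U \<in> sets M" by simp
  qed
  have null_V: "emeasure N (space N - V) = 0"
  proof -
    have "to_group -` (space N - V) \<inter> U = {}" by (auto simp: V_def)
    then show ?thesis using vimage_AE[of "space N - V"] V by simp
  qed
  have rot: "orbit.add (shift_point 1, to_group x) = to_group (T x)" if "x \<in> U" for x
    using that to_group_U(1) TU UX embed_T by (simp add: subset_iff)
  have m1: "to_group \<in> restrict_space M U \<rightarrow>\<^sub>M restrict_space N V"
    by (rule measurable_restrict_space3[OF to_group_measurable_N]) (auto simp: V_def)
  have m2: "inv_into U to_group \<in> restrict_space N V \<rightarrow>\<^sub>M restrict_space M U"
  proof (rule measurable_restrict_space2)
    show "inv_into U to_group \<in> space (restrict_space N V) \<rightarrow> U"
      by (auto simp: space_restrict_space V_def intro: inv_into_into)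
    \<comment> \<open>On \<open>V\<close> the inverse of \<open>to_group\<close> is computed by
      reading off the coordinates and applying the measurable inverse of
      \<open>coords\<close>.\<close>
    have "?J \<in> restrict_space N V \<rightarrow>\<^sub>M restrict_space borel (coords ` B)"
      using V_eq by (intro measurable_restrict_space3[OF J]) (auto simp: W_def)
    from measurable_compose[OF this inv]
    have "(\<lambda>k. inv_into B coords (?J k)) \<in> restrict_space N V \<rightarrow>\<^sub>M M" .
    moreover have "inv_into B coords (?J k) = inv_into U to_group k" if k: "k \<in> space (restrict_space N V)" for k
    proof -
      obtain x where "x \<in> U" "k = to_group x" using k by (auto simp: space_restrict_space V_def)
      then show ?thesis
        using to_group_U(2)[of x] inv_coords[of x] UB inv_into_f_f[OF inj_U] by auto
    qed
    ultimately show "inv_into U to_group \<in> restrict_space N V \<rightarrow>\<^sub>M M"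
      by (simp cong: measurable_cong)
  qed
  have dist: "distr (restrict_space M U) (restrict_space N V) to_group = restrict_space N V"
  proof (rule measure_eqI)
    fix A assume "A \<in> sets (distr (restrict_space M U) (restrict_space N V) to_group)"
    then have A: "A \<in> sets (restrict_space N V)" by simp
    then have A': "A \<in> sets N" "A \<subseteq> V"
      using V by (auto simp: sets_restrict_space_iff)
    have "emeasure (distr (restrict_space M U) (restrict_space N V) to_group) A
        = emeasure (restrict_space M U) (to_group -` A \<inter> U)"
      using emeasure_distr[OF m1 A] UX X_space by (simp add: space_restrict_space Int_absorb2)
    also have "\<dots> = emeasure M (to_group -` A \<inter> U)"
      using U by (intro emeasure_restrict_space) auto
    also have "\<dots> = emeasure N A" by (rule vimage_AE[OF A'(1)])
    also have "\<dots> = emeasure (restrict_space N V) A"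
      using V A' by (simp add: emeasure_restrict_space)
    finally show "emeasure (distr (restrict_space M U) (restrict_space N V) to_group) A
        = emeasure (restrict_space N V) A" .
  qed simp
  show ?thesis
    unfolding isomorphic_mod_0_def
  proof (intro bexI[OF _ U] bexI[OF _ V] exI[of _ to_group] conjI ballI)
    show "T ` U \<subseteq> U" using TU by blast
    show "rotation orbit.G (shift_point 1) ` V \<subseteq> V"
      using rot TU by (auto simp: V_def)
    show "bij_betw to_group U V"
      using inj_U by (simp add: bij_betw_def V_def)
    show "to_group (T x) = shift_point 1 \<otimes>\<^bsub>orbit.G\<^esub> to_group x" if "x \<in> U" for x
      using rot[OF that] by simp
  qed (rule null_U null_V m1 m2 dist)+
qed

lemma isomorphic_to_Kronecker: "isomorphic_to_Kronecker M T"
  by (rule isomorphic_to_KroneckerI[OF orbit.Kronecker_rotation_G Haar_N emeasure_N_space isomorphic_mod_0_N])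

end

theorem theorem3:
  fixes M :: "'a measure" and T :: "'a \<Rightarrow> 'a" and d :: "'a \<Rightarrow> 'a \<Rightarrow> real"
  assumes "mp_system M T"
    and "ergodic M T"
    and "\<not> isomorphic_to_Kronecker M T"
    and "compatible_metric M d"
  shows "pairwise_sensitive M T d"
proof (rule ccontr)
  assume "\<not> pairwise_sensitive M T d"
  then interpret non_sensitive_system M T d
    using assms by (simp add: non_sensitive_system_def non_sensitive_system_axioms_def compatible_metric_def)
  obtain X x0 where "dense_orbit_system M T d X x0"
    using dense_orbit_system_ex by blast
  from dense_orbit_system.isomorphic_to_Kronecker[OF this] assms(3) show False
    by simp
qed

end
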